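(* The following decision problem is undecidable: given a nonempty finite set $\mathcal{P}$ of processes and an HMSC $\mathcal{H}=(S,\iota,\mathit{Msg},R,F,F_\omega)$ over $\mathcal{P}$ such that $\mathit{Msg}$ is a singleton set, decide whether $L(\mathcal{H})\neq\emptyset$.
   Context: Let $\mathcal{P}$ be a nonempty finite set of processes, $\mathit{Ch}=\{(p,q)\in\mathcal{P}\times\mathcal{P}\mid p\neq q\}$, $\mathit{Act}_p=\{p!q\mid (p,q)\in\mathit{Ch}\}\cup\{p?q\mid (q,p)\in\mathit{Ch}\}$, $\mathit{Act}=\bigcup_p\mathit{Act}_p$, and $\mathit{Msg}$ a finite set of messages. A compositional MSC (cMSC) over $\mathcal{P}$ and $\mathit{Msg}$ is a tuple $M=(E,\le,\lhd,\lambda,\mu)$ where $E$ is a nonempty finite or countably infinite set of events, $\le$ a partial order on $E$, $\lambda\colon E\to\mathit{Act}$, $\mu\colon E\rightharpoonup\mathit{Msg}$ partial, such that: for each $p$, with $E_p=\{e\mid\lambda(e)\in\mathit{Act}_p\}$, the restriction $\le_p$ of $\le$ to $E_p$ is a total order, finite or isomorphic to $(\mathbb{N},\le)$; with ${\to}$ the union over $p$ of the direct-successor relations of $\le_p$, the relation ${\lhd}\subseteq{\le}$ satisfies (i) each $(e,f)\in\lhd$ has $\lambda(e)=p!q$, $\lambda(f)=q?p$ for some $(p,q)\in\mathit{Ch}$, (ii) FIFO: for $(e,f),(e',f')\in\lhd$ with $e,e'\in E_p$, $f,f'\in E_q$, $e\le_p e'$ iff $f\le_q f'$; $\le$ is the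 reflexive transitive closure of ${\to}\cup{\lhd}$; with $\mathrm{unm}(M)$ the set of events not related by $\lhd$ to any event, $\mathrm{dom}(\mu)=\mathrm{unm}(M)$; and for all $(e,f)\in\lhd$, $g\in\mathrm{unm}(M)$: $\lambda(g)=\lambda(e)\Rightarrow e<g$ and $\lambda(g)=\lambda(f)\Rightarrow g<f$. $M$ is an MSC if $\mathrm{unm}(M)=\emptyset$; $\mathbb{MSC}$ is the set of MSCs, $\mathrm{fc}\mathbb{MSC}$ the set of finite cMSCs. Concatenation: for $M_1\in\mathrm{fc}\mathbb{MSC}$ and a cMSC $M_2$, $M_1\circ M_2$ is the set of all cMSCs $M$ with $E=E^1\uplus E^2$, ${\le_p}={\le^1_p}\cup{\le^2_p}\cup(E^1_p\times E^2_p)$ for all $p$, ${\lhd^1}\cup{\lhd^2}\subseteq{\lhd}$ and every other pair $(e,f)\in\lhd$ has $e\in E^1$, $f\in E^2$, $\mu^1(e)=\mu^2(f)$, and labels $\lambda$ (and $\mu$ on unmatched events of $M$) inherited from $M_1,M_2$. The infinite product $\prod_{i\ge1}M_i$ of finite cMSCs is defined analogously (new message edges go from $M_i$ to $M_j$ with $i<j$ and equal messages). An HMSC over $\mathcal{P}$ is $\mathcal{H}=(S,\iota,\mathit{Msg},R,F,F_\omega)$ with finite $S$, $\iota\in S$, finite $\mathit{Msg}$, finite $R\subseteq S\times\mathrm{fc}\mathbb{MSC}\times S$, and $F,F_\omega\subseteq S$. A finite path is $\rho=s_0M_1s_1\cdots M_ns_n$ ($n\ge1$, $(s_{i-1},M_i,s_i)\in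 R$), infinite paths analogous; $\mathit{cmscs}(\rho)=M_1\circ\cdots\circ M_n$ (resp. $\prod_i M_i$). A path is accepting if it starts at $\iota$ and is finite ending in $F$, or infinite visiting $F_\omega$ infinitely often. $L(\mathcal{H})=\bigcup\{\mathit{cmscs}(\rho)\mid\rho\text{ accepting}\}\cap\mathbb{MSC}$. *)

theory Defs
  imports Main "HOL-Library.FuncSet" "HOL-Library.Disjoint_Sets" "HOL-Library.Nat_Bijection"
begin

section \<open>Compositional MSCs\<close>

datatype 'p act =
    Send 'p 'p  \<comment> \<open>\<open>Send p q\<close> is \<open>p!q\<close>: \<open>p\<close> sends to \<open>q\<close>\<close>
  | Recv 'p 'p  \<comment> \<open>\<open>Recv p q\<close> is \<open>p?q\<close>: \<open>p\<close> receives from \<open>q\<close>\<close>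

definition Ch :: "'p set \<Rightarrow> ('p \<times> 'p) set" where
  "Ch P = {(p, q) \<in> P \<times> P. p \<noteq> q}"

definition Act_of :: "'p set \<Rightarrow> 'p \<Rightarrow> 'p act set" where
  "Act_of P p = {Send p q | q. (p, q) \<in> Ch P} \<union> {Recv p q | q. (q, p) \<in> Ch P}"

definition Act :: "'p set \<Rightarrow> 'p act set" where
  "Act P = (\<Union>p\<in>P. Act_of P p)"

text \<open>A cMSC has at most countably many events, so events are taken to be natural numbers;
  the event set itself is an arbitrary set of naturals, and the numerical order plays no role.\<close>

record ('p, 'm) cmsc =
  events :: "nat set"
  leq :: "nat rel"
  msg :: "nat rel"
  label :: "nat \<Rightarrow> 'p act"
  content :: "nat \<rightharpoonup> 'm"

definition proc_events :: "'p set \<Rightarrow> ('p, 'm) cmsc \<Rightarrow> 'p \<Rightarrow> nat set" where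
  "proc_events P M p = {e \<in> events M. label M e \<in> Act_of P p}"

definition proc_leq :: "'p set \<Rightarrow> ('p, 'm) cmsc \<Rightarrow> 'p \<Rightarrow> nat rel" where
  "proc_leq P M p = Restr (leq M) (proc_events P M p)"

definition covering :: "'a rel \<Rightarrow> 'a rel" where
  "covering r = {(e, f) \<in> r. e \<noteq> f \<and> \<not> (\<exists>g. g \<noteq> e \<and> g \<noteq> f \<and> (e, g) \<in> r \<and> (g, f) \<in> r)}"

definition proc_succ :: "'p set \<Rightarrow> ('p, 'm) cmsc \<Rightarrow> nat rel" where
  "proc_succ P M = (\<Union>p\<in>P. covering (proc_leq P M p))"

definition order_iso_nat :: "'a set \<Rightarrow> 'a rel \<Rightarrow> bool" where
  "order_iso_nat A r \<longleftrightarrow>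
     (\<exists>h. bij_betw h (UNIV :: nat set) A \<and> (\<forall>i j. (h i, h j) \<in> r \<longleftrightarrow> i \<le> j))"

definition unm :: "('p, 'm) cmsc \<Rightarrow> nat set" where
  "unm M = {e \<in> events M. \<forall>f. (e, f) \<notin> msg M \<and> (f, e) \<notin> msg M}"

text \<open>The labelling is required to be undefined outside the event set, so that a cMSC is
  determined by its mathematical components and can be encoded injectively below.\<close>

definition cMSC :: "'p set \<Rightarrow> 'm set \<Rightarrow> ('p, 'm) cmsc set" where
  "cMSC P Msg = {M.
     events M \<noteq> {} \<and>
     partial_order_on (events M) (leq M) \<and>
     label M \<in> events M \<rightarrow>\<^sub>E Act P \<and>
     (\<forall>p\<in>P. linear_order_on (proc_events P M p) (proc_leq P M p) \<and>
        (finite (proc_events P M p) \<or> order_iso_nat (proc_events P M p) (proc_leq P M p))) \<and>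
     msg M \<subseteq> leq M \<and>
     (\<forall>(e, f)\<in>msg M. \<exists>(p, q)\<in>Ch P. label M e = Send p q \<and> label M f = Recv q p) \<and>
     (\<forall>p\<in>P. \<forall>q\<in>P. \<forall>(e, f)\<in>msg M. \<forall>(e', f')\<in>msg M.
        e \<in> proc_events P M p \<and> e' \<in> proc_events P M p \<and>
        f \<in> proc_events P M q \<and> f' \<in> proc_events P M q \<longrightarrow>
        ((e, e') \<in> proc_leq P M p \<longleftrightarrow> (f, f') \<in> proc_leq P M q)) \<and>
     leq M = Restr ((proc_succ P M \<union> msg M)\<^sup>*) (events M) \<and>
     dom (content M) = unm M \<and> ran (content M) \<subseteq> Msg \<and>
     (\<forall>(e, f)\<in>msg M. \<forall>g\<in>unm M.
        (label M g = label M e \<longrightarrow> (e, g) \<in> leq M \<and> e \<noteq> g) \<and>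
        (label M g = label M f \<longrightarrow> (g, f) \<in> leq M \<and> g \<noteq> f))}"

definition fcMSC :: "'p set \<Rightarrow> 'm set \<Rightarrow> ('p, 'm) cmsc set" where
  "fcMSC P Msg = {M \<in> cMSC P Msg. finite (events M)}"

definition MSC :: "'p set \<Rightarrow> 'm set \<Rightarrow> ('p, 'm) cmsc set" where
  "MSC P Msg = {M \<in> cMSC P Msg. unm M = {}}"


section \<open>Concatenation\<close>

definition cmsc_iso :: "('p, 'm) cmsc \<Rightarrow> ('p, 'm) cmsc \<Rightarrow> bool" where
  "cmsc_iso M N \<longleftrightarrow> (\<exists>h. bij_betw h (events M) (events N) \<and>
     leq N = map_prod h h ` leq M \<and> msg N = map_prod h h ` msg M \<and>
     (\<forall>e\<in>events M. label N (h e) = label M e \<and> content N (h e) = content M e))"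

text \<open>The disjoint union of event sets is formed by first passing to isomorphic copies with
  disjoint event sets. Hence concatenations are closed under isomorphism.\<close>

definition concat_cmsc ::
  "'p set \<Rightarrow> 'm set \<Rightarrow> ('p, 'm) cmsc \<Rightarrow> ('p, 'm) cmsc \<Rightarrow> ('p, 'm) cmsc set" where
  "concat_cmsc P Msg M1 M2 = {M \<in> cMSC P Msg. \<exists>N1 N2.
     cmsc_iso M1 N1 \<and> cmsc_iso M2 N2 \<and>
     events N1 \<inter> events N2 = {} \<and> events M = events N1 \<union> events N2 \<and>
     (\<forall>p\<in>P. proc_leq P M p =
        proc_leq P N1 p \<union> proc_leq P N2 p \<union> proc_events P N1 p \<times> proc_events P N2 p) \<and>
     msg N1 \<union> msg N2 \<subseteq> msg M \<and>
     (\<forall>(e, f)\<in>msg M - (msg N1 \<union> msg N2).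
        e \<in> events N1 \<and> f \<in> events N2 \<and> content N1 e = content N2 f) \<and>
     (\<forall>e\<in>events N1. label M e = label N1 e) \<and>
     (\<forall>e\<in>events N2. label M e = label N2 e) \<and>
     (\<forall>e\<in>unm M \<inter> events N1. content M e = content N1 e) \<and>
     (\<forall>e\<in>unm M \<inter> events N2. content M e = content N2 e)}"

definition inf_prod_cmsc ::
  "'p set \<Rightarrow> 'm set \<Rightarrow> (nat \<Rightarrow> ('p, 'm) cmsc) \<Rightarrow> ('p, 'm) cmsc set" where
  "inf_prod_cmsc P Msg Ms = {M \<in> cMSC P Msg. \<exists>N.
     (\<forall>i. cmsc_iso (Ms i) (N i)) \<and>
     disjoint_family (\<lambda>i. events (N i)) \<and> events M = (\<Union>i. events (N i)) \<and>
     (\<forall>p\<in>P. proc_leq P M p =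
        (\<Union>i. proc_leq P (N i) p) \<union>
        (\<Union>i. \<Union>j\<in>{i<..}. proc_events P (N i) p \<times> proc_events P (N j) p)) \<and>
     (\<Union>i. msg (N i)) \<subseteq> msg M \<and>
     (\<forall>(e, f)\<in>msg M - (\<Union>i. msg (N i)). \<exists>i j. i < j \<and>
        e \<in> events (N i) \<and> f \<in> events (N j) \<and> content (N i) e = content (N j) f) \<and>
     (\<forall>i. \<forall>e\<in>events (N i). label M e = label (N i) e) \<and>
     (\<forall>i. \<forall>e\<in>unm M \<inter> events (N i). content M e = content (N i) e)}"

fun fin_prod_cmsc :: "'p set \<Rightarrow> 'm set \<Rightarrow> ('p, 'm) cmsc list \<Rightarrow> ('p, 'm) cmsc set" where
  "fin_prod_cmsc P Msg [] = {}"  \<comment> \<open>irrelevant: paths have at least one transition\<close>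
| "fin_prod_cmsc P Msg (M # Ms) =
     foldl (\<lambda>X N. \<Union>K\<in>X. concat_cmsc P Msg K N) {M} Ms"


section \<open>HMSCs\<close>

record ('p, 's, 'm) hmsc =
  states :: "'s set"
  init :: 's
  msgs :: "'m set"
  trans_rel :: "('s \<times> ('p, 'm) cmsc \<times> 's) set"
  final :: "'s set"
  final_inf :: "'s set"

definition HMSC :: "'p set \<Rightarrow> ('p, 's, 'm) hmsc set" where
  "HMSC P = {H. finite (states H) \<and> init H \<in> states H \<and> finite (msgs H) \<and>
     finite (trans_rel H) \<and> trans_rel H \<subseteq> states H \<times> fcMSC P (msgs H) \<times> states H \<and>
     final H \<subseteq> states H \<and> final_inf H \<subseteq> states H}"

definition fin_path :: "('p, 's, 'm) hmsc \<Rightarrow> 's list \<Rightarrow> ('p, 'm) cmsc list \<Rightarrow> bool" where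
  "fin_path H ss Ms \<longleftrightarrow> Ms \<noteq> [] \<and> length ss = Suc (length Ms) \<and>
     (\<forall>i<length Ms. (ss ! i, Ms ! i, ss ! Suc i) \<in> trans_rel H)"

definition inf_path :: "('p, 's, 'm) hmsc \<Rightarrow> (nat \<Rightarrow> 's) \<Rightarrow> (nat \<Rightarrow> ('p, 'm) cmsc) \<Rightarrow> bool" where
  "inf_path H s Ms \<longleftrightarrow> (\<forall>i. (s i, Ms i, s (Suc i)) \<in> trans_rel H)"

definition fin_accepting :: "('p, 's, 'm) hmsc \<Rightarrow> 's list \<Rightarrow> ('p, 'm) cmsc list \<Rightarrow> bool" where
  "fin_accepting H ss Ms \<longleftrightarrow> fin_path H ss Ms \<and> hd ss = init H \<and> last ss \<in> final H"

definition inf_accepting ::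
  "('p, 's, 'm) hmsc \<Rightarrow> (nat \<Rightarrow> 's) \<Rightarrow> (nat \<Rightarrow> ('p, 'm) cmsc) \<Rightarrow> bool" where
  "inf_accepting H s Ms \<longleftrightarrow> inf_path H s Ms \<and> s 0 = init H \<and> (\<exists>\<^sub>\<infinity>i. s i \<in> final_inf H)"

definition lang :: "'p set \<Rightarrow> ('p, 's, 'm) hmsc \<Rightarrow> ('p, 'm) cmsc set" where
  "lang P H =
     (\<Union>{fin_prod_cmsc P (msgs H) Ms | ss Ms. fin_accepting H ss Ms} \<union>
      \<Union>{inf_prod_cmsc P (msgs H) Ms | s Ms. inf_accepting H s Ms}) \<inter> MSC P (msgs H)"


section \<open>Decidability\<close>

text \<open>Kleene's partial recursive functions; \<open>rec_eval f xs y\<close> means that \<open>f\<close> applied to the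
  argument tuple \<open>xs\<close> is defined with value \<open>y\<close>.\<close>

datatype recf =
    Zero
  | Succ
  | Proj nat
  | Comp recf "recf list"
  | PrimRec recf recf
  | Mu recf

inductive rec_eval :: "recf \<Rightarrow> nat list \<Rightarrow> nat \<Rightarrow> bool" where
  zero: "rec_eval Zero xs 0"
| succ: "rec_eval Succ [x] (Suc x)"
| proj: "i < length xs \<Longrightarrow> rec_eval (Proj i) xs (xs ! i)"
| comp: "list_all2 (\<lambda>g y. rec_eval g xs y) gs ys \<Longrightarrow> rec_eval f ys z \<Longrightarrow>
    rec_eval (Comp f gs) xs z"
| rec_0: "rec_eval f xs y \<Longrightarrow> rec_eval (PrimRec f g) (0 # xs) y"
| rec_Suc: "rec_eval (PrimRec f g) (n # xs) y \<Longrightarrow> rec_eval g (n # y # xs) z \<Longrightarrow>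
    rec_eval (PrimRec f g) (Suc n # xs) z"
| mu: "rec_eval f (n # xs) 0 \<Longrightarrow> (\<And>i. i < n \<Longrightarrow> \<exists>y. rec_eval f (i # xs) (Suc y)) \<Longrightarrow>
    rec_eval (Mu f) xs n"

lemma rec_eval_deterministic:
  assumes "rec_eval f xs y" "rec_eval f xs z"
  shows "y = z"
  using assms
proof (induction arbitrary: z)
  case (comp xs gs ys f y)
  from comp.prems obtain zs where zs: "list_all2 (\<lambda>g y. rec_eval g xs y) gs zs" "rec_eval f zs z"
    by cases auto
  have "ys = zs"
    using comp.IH(1) zs(1)
    by (intro nth_equalityI) (auto simp: list_all2_conv_all_nth)
  then show ?case
    using comp.IH(2) zs(2) by blast
next
  case (mu f n xs)
  from mu.prems have z: "rec_eval f (z # xs) 0"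
      "\<And>i. i < z \<Longrightarrow> \<exists>y. rec_eval f (i # xs) (Suc y)"
    by (cases; simp)+
  have "\<not> z < n" using mu.IH(2) z(1) by fastforce
  moreover have "\<not> n < z" using mu.IH(1) z(2) by fastforce
  ultimately show ?case by simp
next
  case (rec_Suc f g n xs y z')
  from rec_Suc.prems obtain y' where "rec_eval (PrimRec f g) (n # xs) y'"
      "rec_eval g (n # y' # xs) z"
    by cases auto
  then show ?case using rec_Suc.IH by blast
next
  case (zero xs)
  then show ?case by cases simp
next
  case (succ x)
  then show ?case by cases simp
next
  case (proj i xs)
  from proj.prems show ?case by cases simp
next
  case (rec_0 f xs y g)
  from rec_0.prems show ?case by cases (use rec_0.IH in simp_all)
qed

text \<open>A decision problem consists of a set \<open>I\<close> of instances, an encoding \<open>enc\<close> of instances by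
  natural numbers, and a property \<open>Q\<close>. An algorithm is required to halt with the correct answer on
  every instance; nothing is required on numbers that do not encode an instance.\<close>

definition decidable_problem :: "('a \<Rightarrow> nat) \<Rightarrow> 'a set \<Rightarrow> ('a \<Rightarrow> bool) \<Rightarrow> bool" where
  "decidable_problem enc I Q \<longleftrightarrow>
     (\<exists>f. \<forall>x\<in>I. rec_eval f [enc x] (if Q x then 1 else 0))"


section \<open>Encoding of HMSCs\<close>

text \<open>Finite objects over the natural numbers are encoded by the standard effective
  bijections for pairs, sums, lists and finite sets.\<close>

type_synonym nat_cmsc = "(nat, nat) cmsc"
type_synonym nat_hmsc = "(nat, nat, nat) hmsc"

fun act_code :: "nat act \<Rightarrow> nat" where
  "act_code (Send p q) = sum_encode (Inl (prod_encode (p, q)))"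
| "act_code (Recv p q) = sum_encode (Inr (prod_encode (p, q)))"

definition cmsc_code :: "nat_cmsc \<Rightarrow> nat" where
  "cmsc_code M = list_encode
     [set_encode (events M),
      set_encode (prod_encode ` leq M),
      set_encode (prod_encode ` msg M),
      set_encode ((\<lambda>e. prod_encode (e, act_code (label M e))) ` events M),
      set_encode (prod_encode ` Map.graph (content M))]"

definition hmsc_code :: "nat_hmsc \<Rightarrow> nat" where
  "hmsc_code H = list_encode
     [set_encode (states H),
      init H,
      set_encode (msgs H),
      set_encode ((\<lambda>(s, M, t). list_encode [s, cmsc_code M, t]) ` trans_rel H),
      set_encode (final H),
      set_encode (final_inf H)]"

definition instance_code :: "nat set \<times> nat_hmsc \<Rightarrow> nat" where
  "instance_code = (\<lambda>(P, H). prod_encode (set_encode P, hmsc_code H))"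

definition single_msg_instances :: "(nat set \<times> nat_hmsc) set" where
  "single_msg_instances =
     {(P, H). finite P \<and> P \<noteq> {} \<and> H \<in> HMSC P \<and> is_singleton (msgs H)}"

lemma inj_act_code: "inj act_code"
proof (rule injI)
  fix a b assume "act_code a = act_code b"
  then show "a = b"
    by (cases a; cases b) (auto dest!: injD[OF inj_sum_encode])
qed

lemma inj_on_cmsc_code: "inj_on cmsc_code (fcMSC P Msg)"
proof (rule inj_onI)
  fix M N :: nat_cmsc
  assume M: "M \<in> fcMSC P Msg" and N: "N \<in> fcMSC P Msg" and eq: "cmsc_code M = cmsc_code N"
  have fin: "finite (events K)" "finite (leq K)" "finite (msg K)" "finite (Map.graph (content K))"
    and lab: "label K \<in> extensional (events K)" if "K \<in> fcMSC P Msg" for K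
  proof -
    have K: "K \<in> cMSC P Msg" and e: "finite (events K)"
      using that by (auto simp: fcMSC_def)
    have sub: "leq K \<subseteq> events K \<times> events K" "msg K \<subseteq> leq K"
      using K by (auto simp: cMSC_def order_on_defs)
    have "dom (content K) = unm K"
      using K by (simp add: cMSC_def)
    then have "finite (dom (content K))"
      using e by (simp add: unm_def)
    then show "finite (Map.graph (content K))"
      by (simp add: finite_graph_iff_finite_dom)
    show "label K \<in> extensional (events K)"
      using K by (auto simp: cMSC_def PiE_def)
    show "finite (events K)" by fact
    show "finite (leq K)" "finite (msg K)"
      using sub e by (meson finite_SigmaI finite_subset)+
  qed
  have pe: "A = B" if "set_encode (prod_encode ` A) = set_encode (prod_encode ` B)"
    "finite A" "finite B" for A B
    using that by (simp add: set_encode_eq inj_image_eq_iff[OF inj_prod_encode])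
  have codes:
    "set_encode (events M) = set_encode (events N)"
    "set_encode (prod_encode ` leq M) = set_encode (prod_encode ` leq N)"
    "set_encode (prod_encode ` msg M) = set_encode (prod_encode ` msg N)"
    "set_encode ((\<lambda>e. prod_encode (e, act_code (label M e))) ` events M) =
     set_encode ((\<lambda>e. prod_encode (e, act_code (label N e))) ` events N)"
    "set_encode (prod_encode ` Map.graph (content M)) =
     set_encode (prod_encode ` Map.graph (content N))"
    using eq by (simp_all add: cmsc_code_def)
  have ev: "events M = events N"
    using codes(1) fin(1)[OF M] fin(1)[OF N] by (simp add: set_encode_eq)
  have "(\<lambda>e. prod_encode (e, act_code (label M e))) ` events M =
      (\<lambda>e. prod_encode (e, act_code (label N e))) ` events N"
    using codes(4) fin(1)[OF M] fin(1)[OF N] by (simp add: set_encode_eq)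
  then have "label M e = label N e" if "e \<in> events M" for e
  proof -
    have "prod_encode (e, act_code (label M e)) \<in>
        (\<lambda>e. prod_encode (e, act_code (label N e))) ` events N"
      using that \<open>_ ` events M = _\<close> by blast
    then show ?thesis by (auto simp: inj_eq[OF inj_act_code])
  qed
  then have "label M = label N"
    using lab[OF M] lab[OF N] ev by (auto intro: extensionalityI)
  moreover have "Map.graph (content M) = Map.graph (content N)"
    using codes(5) fin(4)[OF M] fin(4)[OF N] by (rule pe)
  then have some: "content M e = Some m \<longleftrightarrow> content N e = Some m" for e m
    by (simp add: Map.graph_def set_eq_iff)
  have "content M e = content N e" for e
  proof (cases "content N e")
    case None
    then show ?thesis using some[of e] by (metis option.exhaust option.distinct(1))
  next
    case (Some m)
    then show ?thesis using some[of e m] by simp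
  qed
  then have "content M = content N" by (rule ext)
  moreover have "leq M = leq N"
    using codes(2) fin(2)[OF M] fin(2)[OF N] by (rule pe)
  moreover have "msg M = msg N"
    using codes(3) fin(3)[OF M] fin(3)[OF N] by (rule pe)
  ultimately show "M = N"
    using ev by simp
qed

lemma inj_on_instance_code: "inj_on instance_code single_msg_instances"
proof (rule inj_onI, clarify)
  fix P P' and H H' :: nat_hmsc
  assume 1: "(P, H) \<in> single_msg_instances" and 2: "(P', H') \<in> single_msg_instances"
    and eq: "instance_code (P, H) = instance_code (P', H')"
  have fin: "finite Q" "finite (states K)" "finite (msgs K)" "finite (trans_rel K)"
      "finite (final K)" "finite (final_inf K)"
      "trans_rel K \<subseteq> UNIV \<times> fcMSC Q (msgs K) \<times> UNIV"
    if "(Q, K) \<in> single_msg_instances" for Q K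
    using that by (auto simp: single_msg_instances_def HMSC_def intro: finite_subset)
  note f1 = fin[OF 1] and f2 = fin[OF 2]
  let ?c = "\<lambda>(s, M, t). list_encode [s, cmsc_code M, t]"
  have P: "P = P'"
    using eq f1(1) f2(1) by (simp add: instance_code_def set_encode_eq)
  have code: "hmsc_code H = hmsc_code H'"
    using eq by (simp add: instance_code_def)
  have m: "msgs H = msgs H'"
    using code f1(3) f2(3) by (simp add: hmsc_code_def set_encode_eq)
  have "set_encode (?c ` trans_rel H) = set_encode (?c ` trans_rel H')"
    using code by (simp add: hmsc_code_def)
  then have "?c ` trans_rel H = ?c ` trans_rel H'"
    using f1(4) f2(4) by (simp add: set_encode_eq)
  moreover have "inj_on ?c (UNIV \<times> fcMSC P (msgs H) \<times> UNIV)"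
    by (rule inj_onI) (auto dest: inj_onD[OF inj_on_cmsc_code])
  moreover have "trans_rel H' \<subseteq> UNIV \<times> fcMSC P (msgs H) \<times> UNIV"
    using f2(7) P m by simp
  ultimately have "trans_rel H = trans_rel H'"
    using inj_on_image_eq_iff[of ?c _ "trans_rel H" "trans_rel H'"] f1(7) by blast
  then show "P = P' \<and> H = H'"
    using P m code f1 f2 by (simp add: hmsc_code_def set_encode_eq)
qed

end

theory Submission
  imports Defs
begin

text \<open>A channel with a single message content is a counter: an unmatched send increments it, an
  unmatched receive decrements it, and a matched message tests it for zero, since a cMSC has no
  unmatched send before a matched one on the same channel. Acceptance by an MSC means that all
  counters are zero at the end. Hence an HMSC with one message simulates a counter machine, and every
  partial recursive function can be computed by such a machine.

  If \<open>f\<close> decided nonemptiness, let a machine halt on \<open>n\<close> iff \<open>f\<close> rejects the HMSC that loads \<open>n\<close> and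
  then runs the machine whose transitions are coded by \<open>n\<close>. Running this machine on its own code is
  contradictory.\<close>

section \<open>Computable functions\<close>

definition computable :: "nat \<Rightarrow> (nat list \<Rightarrow> nat) \<Rightarrow> bool" where
  "computable k F \<longleftrightarrow> (\<exists>f. \<forall>xs. length xs = k \<longrightarrow> rec_eval f xs (F xs))"

lemma computable_nth: "i < k \<Longrightarrow> computable k (\<lambda>xs. xs ! i)"
  unfolding computable_def by (metis rec_eval.proj)

lemma computable_comp1:
  assumes "computable (Suc 0) (\<lambda>xs. G (xs ! 0))" "computable k A"
  shows "computable k (\<lambda>xs. G (A xs))"
proof -
  obtain g a where g: "\<And>xs. length xs = Suc 0 \<Longrightarrow> rec_eval g xs (G (xs ! 0))"
    and a: "\<And>xs. length xs = k \<Longrightarrow> rec_eval a xs (A xs)"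
    using assms unfolding computable_def by blast
  have "rec_eval (Comp g [a]) xs (G (A xs))" if "length xs = k" for xs
    using a[OF that] g[of "[A xs]"] by (intro rec_eval.comp[of _ _ "[A xs]"]) auto
  then show ?thesis unfolding computable_def by blast
qed

lemma computable_comp2:
  assumes "computable 2 (\<lambda>xs. G (xs ! 0) (xs ! 1))" "computable k A" "computable k B"
  shows "computable k (\<lambda>xs. G (A xs) (B xs))"
proof -
  obtain g a b where g: "\<And>xs. length xs = 2 \<Longrightarrow> rec_eval g xs (G (xs ! 0) (xs ! 1))"
    and a: "\<And>xs. length xs = k \<Longrightarrow> rec_eval a xs (A xs)"
    and b: "\<And>xs. length xs = k \<Longrightarrow> rec_eval b xs (B xs)"
    using assms unfolding computable_def by blast
  have "rec_eval (Comp g [a, b]) xs (G (A xs) (B xs))" if "length xs = k" for xs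
    using a[OF that] b[OF that] g[of "[A xs, B xs]"]
    by (intro rec_eval.comp[of _ _ "[A xs, B xs]"]) auto
  then show ?thesis unfolding computable_def by blast
qed

lemma computable_Suc: "computable k A \<Longrightarrow> computable k (\<lambda>xs. Suc (A xs))"
proof (rule computable_comp1[where G = Suc])
  have "rec_eval Succ xs (Suc (xs ! 0))" if "length xs = Suc 0" for xs
    using that by (auto simp: length_Suc_conv intro: rec_eval.succ)
  then show "computable (Suc 0) (\<lambda>xs. Suc (xs ! 0))" unfolding computable_def by blast
qed

lemma computable_const: "computable k (\<lambda>_. c)"
proof (induction c)
  case 0
  show ?case unfolding computable_def using rec_eval.zero by blast
qed (rule computable_Suc)

lemma computable_add:
  assumes "computable k A" "computable k B"
  shows "computable k (\<lambda>xs. A xs + B xs)"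
proof (rule computable_comp2[OF _ assms])
  have "rec_eval (PrimRec (Proj 0) (Comp Succ [Proj 1])) [m, n] (m + n)" for m n
  proof (induction m)
    case 0
    have "rec_eval (Proj 0) [n] ([n] ! 0)" by (rule rec_eval.proj) simp
    then show ?case by (auto intro: rec_eval.rec_0)
  next
    case (Suc m)
    have "rec_eval (Proj 1) [m, m + n, n] ([m, m + n, n] ! 1)" by (rule rec_eval.proj) simp
    then have "rec_eval (Comp Succ [Proj 1]) [m, m + n, n] (Suc (m + n))"
      by (intro rec_eval.comp[of _ _ "[m + n]"] rec_eval.succ) simp
    with Suc show ?case by (auto intro: rec_eval.rec_Suc)
  qed
  then have "rec_eval (PrimRec (Proj 0) (Comp Succ [Proj 1])) xs (xs ! 0 + xs ! 1)"
    if "length xs = 2" for xs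
    using that by (auto simp: numeral_2_eq_2 length_Suc_conv)
  then show "computable 2 (\<lambda>xs. xs ! 0 + xs ! 1)" unfolding computable_def by blast
qed

lemma computable_primrec:
  assumes G: "computable 2 (\<lambda>xs. G (xs ! 0) (xs ! 1))"
    and F: "\<And>n. F (Suc n) = G n (F n)" and A: "computable k A"
  shows "computable k (\<lambda>xs. F (A xs))"
proof (rule computable_comp1[OF _ A])
  obtain c where c: "\<And>xs. length xs = 0 \<Longrightarrow> rec_eval c xs (F 0)"
    using computable_const[of 0 "F 0"] unfolding computable_def by blast
  obtain g where g: "\<And>xs. length xs = 2 \<Longrightarrow> rec_eval g xs (G (xs ! 0) (xs ! 1))"
    using G unfolding computable_def by blast
  have "rec_eval (PrimRec c g) [n] (F n)" for n
  proof (induction n)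
    case 0
    show ?case by (rule rec_eval.rec_0) (rule c, simp)
  next
    case (Suc n)
    then show ?case using g[of "[n, F n]"] by (auto simp: F intro: rec_eval.rec_Suc)
  qed
  then have "rec_eval (PrimRec c g) xs (F (xs ! 0))" if "length xs = Suc 0" for xs
    using that by (auto simp: length_Suc_conv)
  then show "computable (Suc 0) (\<lambda>xs. F (xs ! 0))" unfolding computable_def by blast
qed

lemma computable_power2: "computable k A \<Longrightarrow> computable k (\<lambda>xs. 2 ^ A xs)"
proof (rule computable_primrec[where F = "\<lambda>n. 2 ^ n" and G = "\<lambda>_ y. y + y"])
  show "computable 2 (\<lambda>xs. xs ! 1 + xs ! 1)"
    by (intro computable_add computable_nth) simp_all
qed simp_all

lemma computable_power2_minus_1: "computable k A \<Longrightarrow> computable k (\<lambda>xs. 2 ^ A xs - 1)"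
proof (rule computable_primrec[where F = "\<lambda>n. 2 ^ n - 1" and G = "\<lambda>_ y. Suc (y + y)"])
  show "computable 2 (\<lambda>xs. Suc (xs ! 1 + xs ! 1))"
    by (intro computable_Suc computable_add computable_nth) simp_all
  show "2 ^ Suc n - 1 = Suc (2 ^ n - 1 + (2 ^ n - 1))" for n :: nat
    using one_le_power[of "2::nat" n] unfolding power_Suc by linarith
qed

lemma computable_prod_encode:
  assumes A: "computable k A" and B: "computable k B"
  shows "computable k (\<lambda>xs. prod_encode (A xs, B xs))"
proof -
  have "computable k (\<lambda>xs. triangle (A xs + B xs))"
  proof (rule computable_primrec[where F = triangle and G = "\<lambda>n y. y + Suc n"])
    show "computable 2 (\<lambda>xs. xs ! 1 + Suc (xs ! 0))"
      by (intro computable_add computable_Suc computable_nth) simp_all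
    show "computable k (\<lambda>xs. A xs + B xs)"
      by (intro computable_add A B)
  qed simp
  then show ?thesis by (simp add: prod_encode_def computable_add A)
qed

lemma computable_list_encode:
  "(\<And>A. A \<in> set As \<Longrightarrow> computable k A) \<Longrightarrow> computable k (\<lambda>xs. list_encode (map (\<lambda>A. A xs) As))"
  by (induction As) (simp_all add: computable_const computable_Suc computable_prod_encode)

lemma computable_sum_power2:
  assumes h: "computable (Suc 0) (\<lambda>xs. h (xs ! 0))" and A: "computable k A"
  shows "computable k (\<lambda>xs. \<Sum>j<A xs. 2 ^ h j)"
proof (rule computable_primrec[where F = "\<lambda>n. \<Sum>j<n. 2 ^ h j" and G = "\<lambda>n y. y + 2 ^ h n"])
  have "computable 2 (\<lambda>xs. h (xs ! 0))"
    by (rule computable_comp1[OF h]) (simp add: computable_nth)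
  then show "computable 2 (\<lambda>xs. xs ! 1 + 2 ^ h (xs ! 0))"
    by (intro computable_add computable_power2) (simp_all add: computable_nth)
qed (simp_all add: A)

section \<open>Counter programs for partial recursive functions\<close>

type_synonym store = "nat \<Rightarrow> nat"

datatype counter_op = Inc nat | Dec nat | Tst nat

fun op_rel :: "counter_op \<Rightarrow> store rel" where
  "op_rel (Inc r) = {(\<sigma>, \<tau>). \<tau> = \<sigma>(r := Suc (\<sigma> r))}"
| "op_rel (Dec r) = {(\<sigma>, \<tau>). \<sigma> r \<noteq> 0 \<and> \<tau> = \<sigma>(r := \<sigma> r - 1)}"
| "op_rel (Tst r) = {(\<sigma>, \<tau>). \<sigma> r = 0 \<and> \<tau> = \<sigma>}"

inductive flowchart :: "store rel \<Rightarrow> bool" where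
  flow_op: "flowchart (op_rel c)"
| flow_seq: "flowchart R \<Longrightarrow> flowchart S \<Longrightarrow> flowchart (R O S)"
| flow_star: "flowchart R \<Longrightarrow> flowchart (R\<^sup>*)"

lemma in_op_rel:
  "(\<sigma>, \<tau>) \<in> op_rel (Inc r) \<longleftrightarrow> \<tau> = \<sigma>(r := Suc (\<sigma> r))"
  "(\<sigma>, \<tau>) \<in> op_rel (Dec r) \<longleftrightarrow> \<sigma> r \<noteq> 0 \<and> \<tau> = \<sigma>(r := \<sigma> r - 1)"
  "(\<sigma>, \<tau>) \<in> op_rel (Tst r) \<longleftrightarrow> \<sigma> r = 0 \<and> \<tau> = \<sigma>"
  by auto

declare op_rel.simps [simp del]

lemma in_relcomp: "(x, z) \<in> R O S \<longleftrightarrow> (\<exists>y. (x, y) \<in> R \<and> (y, z) \<in> S)"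
  by auto

lemma ex_image_conj: "(\<exists>y. (\<exists>x. P x \<and> y = f x) \<and> Q y) \<longleftrightarrow> (\<exists>x. P x \<and> Q (f x))"
  by blast

lemma in_star_comp: "(x, z) \<in> R\<^sup>* O S \<longleftrightarrow> (\<exists>k y. (x, y) \<in> R ^^ k \<and> (y, z) \<in> S)"
  unfolding in_relcomp rtrancl_power by blast

lemma Inc_Dec_Id: "op_rel (Inc r) O op_rel (Dec r) = Id"
  by (auto simp: in_relcomp in_op_rel)

lemma flow_skip: "flowchart Id"
  using flow_seq[OF flow_op flow_op, of "Inc 0" "Dec 0"] by (simp add: Inc_Dec_Id)

lemma flow_fail: "flowchart {}"
proof -
  have "op_rel (Inc 0) O op_rel (Tst 0) = {}" by (auto simp: in_relcomp in_op_rel)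
  then show ?thesis by (metis flowchart.intros)
qed

definition clear :: "nat \<Rightarrow> store rel" where
  "clear a = {(\<sigma>, \<tau>). \<tau> = \<sigma>(a := 0)}"

definition move :: "nat \<Rightarrow> nat \<Rightarrow> store rel" where
  "move a b = {(\<sigma>, \<tau>). \<tau> = \<sigma>(a := 0, b := \<sigma> b + \<sigma> a)}"

definition move2 :: "nat \<Rightarrow> nat \<Rightarrow> nat \<Rightarrow> store rel" where
  "move2 a b c = {(\<sigma>, \<tau>). \<tau> = \<sigma>(a := 0, b := \<sigma> b + \<sigma> a, c := \<sigma> c + \<sigma> a)}"

lemma in_clear: "(\<sigma>, \<tau>) \<in> clear a \<longleftrightarrow> \<tau> = \<sigma>(a := 0)"
  by (simp add: clear_def)

lemma in_move: "(\<sigma>, \<tau>) \<in> move a b \<longleftrightarrow> \<tau> = \<sigma>(a := 0, b := \<sigma> b + \<sigma> a)"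
  by (simp add: move_def)

lemma in_move2:
  "(\<sigma>, \<tau>) \<in> move2 a b c \<longleftrightarrow> \<tau> = \<sigma>(a := 0, b := \<sigma> b + \<sigma> a, c := \<sigma> c + \<sigma> a)"
  by (simp add: move2_def)

lemma flow_clear: "flowchart (clear a)"
proof -
  have pow: "(\<sigma>, \<tau>) \<in> op_rel (Dec a) ^^ k \<longleftrightarrow> k \<le> \<sigma> a \<and> \<tau> = \<sigma>(a := \<sigma> a - k)" for k \<sigma> \<tau>
    by (induction k arbitrary: \<tau>) (auto simp: in_relcomp in_op_rel)
  have "(\<sigma>, \<tau>) \<in> (op_rel (Dec a))\<^sup>* O op_rel (Tst a) \<longleftrightarrow> (\<sigma>, \<tau>) \<in> clear a" for \<sigma> \<tau>
    unfolding in_star_comp pow in_op_rel in_clear by (auto intro: exI[of _ "\<sigma> a"])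
  then have "(op_rel (Dec a))\<^sup>* O op_rel (Tst a) = clear a" by auto
  then show ?thesis by (metis flowchart.intros)
qed

lemma flow_move2:
  assumes "a \<noteq> b" "a \<noteq> c" "b \<noteq> c"
  shows "flowchart (move2 a b c)"
proof -
  define D where "D = op_rel (Dec a) O op_rel (Inc b) O op_rel (Inc c)"
  have D: "(\<sigma>, \<tau>) \<in> D \<longleftrightarrow> \<sigma> a \<noteq> 0 \<and> \<tau> = \<sigma>(a := \<sigma> a - 1, b := Suc (\<sigma> b), c := Suc (\<sigma> c))"
    for \<sigma> \<tau>
    using assms by (auto simp: D_def in_relcomp in_op_rel)
  have pow: "(\<sigma>, \<tau>) \<in> D ^^ k \<longleftrightarrow>
      k \<le> \<sigma> a \<and> \<tau> = \<sigma>(a := \<sigma> a - k, b := \<sigma> b + k, c := \<sigma> c + k)" for k \<sigma> \<tau>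
  proof (induction k arbitrary: \<tau>)
    case (Suc k)
    have "\<sigma>(a := \<sigma> a - k, b := \<sigma> b + k, c := \<sigma> c + k, a := x, b := y, c := z) = \<sigma>(a := x, b := y, c := z)"
      for x y z by auto
    then show ?case using assms by (auto simp: in_relcomp D Suc)
  qed auto
  have "(\<sigma>, \<tau>) \<in> D\<^sup>* O op_rel (Tst a) \<longleftrightarrow> (\<sigma>, \<tau>) \<in> move2 a b c" for \<sigma> \<tau>
    unfolding in_star_comp pow in_op_rel in_move2 using assms by (auto intro: exI[of _ "\<sigma> a"])
  then have "D\<^sup>* O op_rel (Tst a) = move2 a b c" by auto
  moreover have "flowchart D"
    unfolding D_def by (intro flow_seq flow_op)
  ultimately show ?thesis by (metis flowchart.intros)
qed

lemma flow_move:
  assumes "a \<noteq> b"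
  shows "flowchart (move a b)"
proof -
  define D where "D = op_rel (Dec a) O op_rel (Inc b)"
  have D: "(\<sigma>, \<tau>) \<in> D \<longleftrightarrow> \<sigma> a \<noteq> 0 \<and> \<tau> = \<sigma>(a := \<sigma> a - 1, b := Suc (\<sigma> b))" for \<sigma> \<tau>
    using assms by (auto simp: D_def in_relcomp in_op_rel)
  have pow: "(\<sigma>, \<tau>) \<in> D ^^ k \<longleftrightarrow> k \<le> \<sigma> a \<and> \<tau> = \<sigma>(a := \<sigma> a - k, b := \<sigma> b + k)" for k \<sigma> \<tau>
  proof (induction k arbitrary: \<tau>)
    case (Suc k)
    have "\<sigma>(a := \<sigma> a - k, b := \<sigma> b + k, a := x, b := y) = \<sigma>(a := x, b := y)" for x y by auto
    then show ?case using assms by (auto simp: in_relcomp D Suc)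
  qed auto
  have "(\<sigma>, \<tau>) \<in> D\<^sup>* O op_rel (Tst a) \<longleftrightarrow> (\<sigma>, \<tau>) \<in> move a b" for \<sigma> \<tau>
    unfolding in_star_comp pow in_op_rel in_move using assms by (auto intro: exI[of _ "\<sigma> a"])
  then have "D\<^sup>* O op_rel (Tst a) = move a b" by auto
  moreover have "flowchart D"
    unfolding D_def by (intro flow_seq flow_op)
  ultimately show ?thesis by (metis flowchart.intros)
qed

text \<open>Registers from \<open>b\<close> on are scratch space: they are zero before and after the computation, and the
  result is added to register \<open>c\<close>.\<close>

definition implements :: "recf \<Rightarrow> nat list \<Rightarrow> nat \<Rightarrow> nat \<Rightarrow> store rel \<Rightarrow> bool" where
  "implements f rs c b R \<longleftrightarrow> flowchart R \<and>
     (\<forall>\<sigma> \<tau>. (\<forall>r\<ge>b. \<sigma> r = 0) \<longrightarrow>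
        ((\<sigma>, \<tau>) \<in> R \<longleftrightarrow> (\<exists>y. rec_eval f (map \<sigma> rs) y \<and> \<tau> = \<sigma>(c := \<sigma> c + y))))"

lemma implementsD:
  assumes "implements f rs c b R" "\<And>r. b \<le> r \<Longrightarrow> \<sigma> r = 0"
  shows "(\<sigma>, \<tau>) \<in> R \<longleftrightarrow> (\<exists>y. rec_eval f (map \<sigma> rs) y \<and> \<tau> = \<sigma>(c := \<sigma> c + y))"
  using assms unfolding implements_def by blast

inductive_simps rec_eval_Zero [simp]: "rec_eval Zero xs y"
inductive_simps rec_eval_Succ: "rec_eval Succ xs y"
inductive_simps rec_eval_Proj: "rec_eval (Proj i) xs y"
inductive_simps rec_eval_Comp: "rec_eval (Comp f gs) xs y"
inductive_simps rec_eval_PrimRec_Nil: "rec_eval (PrimRec f g) [] y"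
inductive_simps rec_eval_PrimRec_0: "rec_eval (PrimRec f g) (0 # xs) y"
inductive_simps rec_eval_PrimRec_Suc: "rec_eval (PrimRec f g) (Suc n # xs) y"
inductive_simps rec_eval_Mu: "rec_eval (Mu f) xs y"

lemma flow_copy:
  assumes "r < b" "c < b" "r \<noteq> c"
  obtains R where "flowchart R"
    "\<And>\<sigma> \<tau>. \<sigma> b = 0 \<Longrightarrow> (\<sigma>, \<tau>) \<in> R \<longleftrightarrow> \<tau> = \<sigma>(c := \<sigma> c + \<sigma> r)"
proof
  show "flowchart (move2 r c b O move b r)"
    using assms by (intro flow_seq flow_move2 flow_move) auto
  show "(\<sigma>, \<tau>) \<in> move2 r c b O move b r \<longleftrightarrow> \<tau> = \<sigma>(c := \<sigma> c + \<sigma> r)" if "\<sigma> b = 0" for \<sigma> \<tau>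
  proof -
    have "(\<sigma>, \<tau>) \<in> move2 r c b O move b r \<longleftrightarrow>
        \<tau> = \<sigma>(r := 0, c := \<sigma> c + \<sigma> r, b := \<sigma> r, b := 0, r := \<sigma> r)"
      using assms that by (simp add: in_relcomp in_move in_move2)
    also have "\<sigma>(r := 0, c := \<sigma> c + \<sigma> r, b := \<sigma> r, b := 0, r := \<sigma> r) = \<sigma>(c := \<sigma> c + \<sigma> r)"
      using assms that by (auto simp: fun_eq_iff)
    finally show ?thesis .
  qed
qed

lemma list_all2_snoc1:
  "list_all2 P (xs @ [x]) zs \<longleftrightarrow> (\<exists>ys y. zs = ys @ [y] \<and> list_all2 P xs ys \<and> P x y)"
proof
  assume "list_all2 P (xs @ [x]) zs"
  then show "\<exists>ys y. zs = ys @ [y] \<and> list_all2 P xs ys \<and> P x y"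
    by (auto simp: list_all2_append1 list_all2_Cons1)
qed (auto simp: list_all2_appendI)

lemma implement_Comp_args:
  assumes "\<And>g rs c b. g \<in> set gs \<Longrightarrow> set rs \<subseteq> {..<b} \<Longrightarrow> c < b \<Longrightarrow> c \<notin> set rs \<Longrightarrow>
      \<exists>R. implements g rs c b R"
    and "set rs \<subseteq> {..<m}" "m + length gs \<le> b"
  shows "\<exists>R. flowchart R \<and> (\<forall>\<sigma> \<tau>. (\<forall>r\<ge>m. \<sigma> r = 0) \<longrightarrow> ((\<sigma>, \<tau>) \<in> R \<longleftrightarrow>
     (\<exists>ys. list_all2 (\<lambda>g y. rec_eval g (map \<sigma> rs) y) gs ys \<and>
       \<tau> = (\<lambda>i. if m \<le> i \<and> i < m + length gs then ys ! (i - m) else \<sigma> i))))"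
  using assms
proof (induction gs rule: rev_induct)
  case Nil
  show ?case by (rule exI[of _ Id]) (auto simp: flow_skip)
next
  case (snoc g gs)
  from snoc.prems obtain S where S: "implements g rs (m + length gs) b S"
    by (atomize_elim, intro snoc.prems(1)) fastforce+
  obtain R where R: "flowchart R" and R2: "\<And>\<sigma> \<tau>. (\<forall>r\<ge>m. \<sigma> r = 0) \<Longrightarrow> ((\<sigma>, \<tau>) \<in> R \<longleftrightarrow>
     (\<exists>ys. list_all2 (\<lambda>g y. rec_eval g (map \<sigma> rs) y) gs ys \<and>
       \<tau> = (\<lambda>i. if m \<le> i \<and> i < m + length gs then ys ! (i - m) else \<sigma> i)))"
    using snoc by (auto)
  show ?case
  proof (intro exI[of _ "R O S"] conjI allI impI)
    show "flowchart (R O S)" using R S by (auto simp: implements_def intro: flow_seq)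
    fix \<sigma> \<tau> :: store assume \<sigma>: "\<forall>r\<ge>m. \<sigma> r = 0"
    let ?f = "\<lambda>ys i. if m \<le> i \<and> i < m + length gs then ys ! (i - m) else \<sigma> i"
    let ?f' = "\<lambda>ys i. if m \<le> i \<and> i < m + length (gs @ [g]) then ys ! (i - m) else \<sigma> i"
    have mp: "map (?f ys) rs = map \<sigma> rs" for ys
      using snoc.prems(2) by auto
    have S': "(?f ys, \<tau>) \<in> S \<longleftrightarrow> (\<exists>y. rec_eval g (map \<sigma> rs) y \<and> \<tau> = ?f' (ys @ [y]))"
      if "length ys = length gs" for ys
    proof -
      have "(?f ys)(m + length gs := ?f ys (m + length gs) + y) = ?f' (ys @ [y])" for y
        using that \<sigma> by (auto simp: fun_eq_iff nth_append)
      then show ?thesis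
        using \<sigma> snoc.prems(3) by (subst implementsD[OF S]) (auto simp: mp)
    qed
    have "(\<sigma>, \<tau>) \<in> R O S \<longleftrightarrow> (\<exists>ys. list_all2 (\<lambda>g y. rec_eval g (map \<sigma> rs) y) gs ys \<and> (?f ys, \<tau>) \<in> S)"
      using R2[OF \<sigma>] by (auto simp: in_relcomp)
    also have "\<dots> \<longleftrightarrow> (\<exists>ys. list_all2 (\<lambda>g y. rec_eval g (map \<sigma> rs) y) gs ys \<and>
        (\<exists>y. rec_eval g (map \<sigma> rs) y \<and> \<tau> = ?f' (ys @ [y])))"
      by (intro ex_cong1 conj_cong refl S') (simp add: list_all2_lengthD)
    also have "\<dots> \<longleftrightarrow> (\<exists>ys. list_all2 (\<lambda>g y. rec_eval g (map \<sigma> rs) y) (gs @ [g]) ys \<and> \<tau> = ?f' ys)"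
      unfolding list_all2_snoc1 by blast
    finally show "(\<sigma>, \<tau>) \<in> R O S \<longleftrightarrow> \<dots>" .
  qed
qed

definition clear_range :: "nat \<Rightarrow> nat \<Rightarrow> store rel" where
  "clear_range m n = {(\<sigma>, \<tau>). \<tau> = (\<lambda>i. if m \<le> i \<and> i < m + n then 0 else \<sigma> i)}"

lemma flow_clear_range: "flowchart (clear_range m n)"
proof (induction n)
  case 0
  have "clear_range m 0 = Id" by (auto simp: fun_eq_iff clear_range_def)
  then show ?case using flow_skip by metis
next
  case (Suc n)
  have "(\<lambda>i. if m \<le> i \<and> i < m + n then 0 else \<sigma> i)(m + n := 0) =
      (\<lambda>i. if m \<le> i \<and> i < m + Suc n then 0 else \<sigma> i)" for \<sigma> :: store
    by (auto simp: fun_eq_iff less_Suc_eq)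
  then have "clear_range m n O clear (m + n) = clear_range m (Suc n)"
    by (auto simp: clear_range_def clear_def in_relcomp)
  then show ?case using flow_seq[OF Suc flow_clear[of "m + n"]] by simp
qed

lemma implementable_Comp:
  assumes IH: "\<And>g rs c b. g \<in> insert f (set gs) \<Longrightarrow> set rs \<subseteq> {..<b} \<Longrightarrow> c < b \<Longrightarrow> c \<notin> set rs \<Longrightarrow>
      \<exists>R. implements g rs c b R"
    and rs: "set rs \<subseteq> {..<b}" "c < b" "c \<notin> set rs"
  shows "\<exists>R. implements (Comp f gs) rs c b R"
proof -
  let ?k = "length gs"
  have "\<exists>R. flowchart R \<and> (\<forall>\<sigma> \<tau>. (\<forall>r\<ge>b. \<sigma> r = 0) \<longrightarrow> ((\<sigma>, \<tau>) \<in> R \<longleftrightarrow>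
     (\<exists>ys. list_all2 (\<lambda>g y. rec_eval g (map \<sigma> rs) y) gs ys \<and>
       \<tau> = (\<lambda>i. if b \<le> i \<and> i < b + ?k then ys ! (i - b) else \<sigma> i))))"
    by (rule implement_Comp_args[of gs rs b "b + ?k"]) (use IH rs in auto)
  then obtain R where R: "flowchart R" and R2: "\<And>\<sigma> \<tau>. (\<forall>r\<ge>b. \<sigma> r = 0) \<Longrightarrow> ((\<sigma>, \<tau>) \<in> R \<longleftrightarrow>
     (\<exists>ys. list_all2 (\<lambda>g y. rec_eval g (map \<sigma> rs) y) gs ys \<and>
       \<tau> = (\<lambda>i. if b \<le> i \<and> i < b + ?k then ys ! (i - b) else \<sigma> i)))"
    by blast
  have "\<exists>S. implements f [b..<b + ?k] c (b + ?k) S"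
    using rs by (intro IH) auto
  then obtain S where S: "implements f [b..<b + ?k] c (b + ?k) S" ..
  let ?C = "clear_range b ?k"
  have "implements (Comp f gs) rs c b (R O S O ?C)"
    unfolding implements_def
  proof (intro conjI allI impI)
    show "flowchart (R O S O ?C)"
      using R S by (auto simp: implements_def intro!: flow_seq flow_clear_range)
    fix \<sigma> \<tau> :: store assume \<sigma>: "\<forall>r\<ge>b. \<sigma> r = 0"
    let ?f = "\<lambda>ys i. if b \<le> i \<and> i < b + ?k then ys ! (i - b) else \<sigma> i"
    have S': "(?f ys, \<tau>) \<in> S O ?C \<longleftrightarrow> (\<exists>y. rec_eval f ys y \<and> \<tau> = \<sigma>(c := \<sigma> c + y))"
      if "length ys = ?k" for ys
    proof -
      have mp: "map (?f ys) [b..<b + ?k] = ys"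
        by (rule nth_equalityI) (auto simp: that)
      have c: "?f ys c = \<sigma> c" using rs(2) by simp
      have 1: "(?f ys, \<rho>) \<in> S \<longleftrightarrow> (\<exists>y. rec_eval f ys y \<and> \<rho> = (?f ys)(c := \<sigma> c + y))" for \<rho>
        by (subst implementsD[OF S]) (simp add: \<sigma>, simp only: mp c)
      have 2: "((?f ys)(c := \<sigma> c + y), \<tau>) \<in> ?C \<longleftrightarrow> \<tau> = \<sigma>(c := \<sigma> c + y)" for y
      proof -
        have "(\<lambda>i. if b \<le> i \<and> i < b + ?k then 0 else ((?f ys)(c := \<sigma> c + y)) i) = \<sigma>(c := \<sigma> c + y)"
          using \<sigma> rs(2) by (auto simp: fun_eq_iff)
        then show ?thesis by (simp add: clear_range_def)
      qed
      show ?thesis unfolding in_relcomp 1 ex_image_conj 2 ..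
    qed
    have "(\<sigma>, \<tau>) \<in> R O S O ?C \<longleftrightarrow>
        (\<exists>ys. list_all2 (\<lambda>g y. rec_eval g (map \<sigma> rs) y) gs ys \<and> (?f ys, \<tau>) \<in> S O ?C)"
      unfolding in_relcomp[of _ _ R] R2[OF \<sigma>] by blast
    also have "\<dots> \<longleftrightarrow> (\<exists>ys. list_all2 (\<lambda>g y. rec_eval g (map \<sigma> rs) y) gs ys \<and>
        (\<exists>y. rec_eval f ys y \<and> \<tau> = \<sigma>(c := \<sigma> c + y)))"
      by (intro ex_cong1 conj_cong refl S') (simp add: list_all2_lengthD)
    finally show "(\<sigma>, \<tau>) \<in> R O S O ?C \<longleftrightarrow>
        (\<exists>y. rec_eval (Comp f gs) (map \<sigma> rs) y \<and> \<tau> = \<sigma>(c := \<sigma> c + y))"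
      by (auto simp: rec_eval_Comp)
  qed
  then show ?thesis by blast
qed

lemma implementable_PrimRec:
  assumes IH: "\<And>h rs c b. h \<in> {f, g} \<Longrightarrow> set rs \<subseteq> {..<b} \<Longrightarrow> c < b \<Longrightarrow> c \<notin> set rs \<Longrightarrow>
      \<exists>R. implements h rs c b R"
    and prems: "set (r # rs) \<subseteq> {..<b}" "c < b" "c \<notin> set (r # rs)"
  shows "\<exists>R. implements (PrimRec f g) (r # rs) c b R"
proof -
  define N K A B where "N = b" and "K = b + 1" and "A = b + 2" and "B = b + 3"
  note regs = N_def K_def A_def B_def
  obtain C where C: "flowchart C"
    "\<And>\<sigma> \<tau>. \<sigma> (b + 4) = 0 \<Longrightarrow> (\<sigma>, \<tau>) \<in> C \<longleftrightarrow> \<tau> = \<sigma>(N := \<sigma> N + \<sigma> r)"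
    using flow_copy[of r "b + 4" N] prems by (auto simp: regs)
  have "\<exists>R. implements f rs A (b + 4) R"
    using prems by (intro IH) (auto simp: regs)
  then obtain R where R: "implements f rs A (b + 4) R" ..
  have "\<exists>S. implements g (K # A # rs) B (b + 4) S"
    using prems by (intro IH) (auto simp: regs)
  then obtain S where S: "implements g (K # A # rs) B (b + 4) S" ..
  define X where "X = clear A O move B A O op_rel (Inc K)"
  define L where "L = op_rel (Dec N) O S O X"
  define E where "E = op_rel (Tst N) O move A c O clear K"
  have "implements (PrimRec f g) (r # rs) c b ((C O R) O L\<^sup>* O E)"
    unfolding implements_def
  proof (intro conjI allI impI)
    show "flowchart ((C O R) O L\<^sup>* O E)"
      using C R S prems(2) unfolding L_def X_def E_def
      by (intro flow_seq flow_star flow_op flow_move flow_clear) (auto simp: implements_def regs)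
    fix \<sigma> \<tau> :: store assume \<sigma>: "\<forall>r\<ge>b. \<sigma> r = 0"
    let ?xs = "map \<sigma> rs"
    let ?s = "\<lambda>n k a. \<sigma>(N := n, K := k, A := a)"
    have "N \<notin> set rs" "K \<notin> set rs" "A \<notin> set rs"
      using prems by (auto simp: regs)
    then have rs: "map (?s n k a) rs = ?xs" "map (\<sigma>(N := n)) rs = ?xs" for n k a
      by simp_all
    have L: "(?s n k a, \<tau>) \<in> L \<longleftrightarrow>
        n \<noteq> 0 \<and> (\<exists>y. rec_eval g (k # a # ?xs) y \<and> \<tau> = ?s (n - 1) (Suc k) y)" for n k a \<tau>
    proof -
      have S': "(?s n k a, \<rho>) \<in> S \<longleftrightarrow>
          (\<exists>y. rec_eval g (k # a # ?xs) y \<and> \<rho> = (?s n k a)(B := y))" for n \<rho>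
      proof -
        have m: "map (?s n k a) (K # A # rs) = k # a # ?xs" "?s n k a B = 0"
          using \<sigma> by (simp_all add: rs) (simp_all add: regs)
        have "(?s n k a, \<rho>) \<in> S \<longleftrightarrow> (\<exists>y. rec_eval g (map (?s n k a) (K # A # rs)) y \<and>
            \<rho> = (?s n k a)(B := ?s n k a B + y))"
          by (rule implementsD[OF S]) (simp add: \<sigma> regs)
        then show ?thesis unfolding m by simp
      qed
      have 0: "(?s n k a, \<rho>) \<in> op_rel (Dec N) \<longleftrightarrow> n \<noteq> 0 \<and> \<rho> = ?s (n - 1) k a" for \<rho>
      proof -
        have "(?s n k a)(N := n - 1) = ?s (n - 1) k a" "?s n k a N = n"
          by (auto simp: regs fun_eq_iff)
        then show ?thesis by (simp add: in_op_rel)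
      qed
      have 2: "((?s n' k a)(B := y), \<tau>) \<in> X \<longleftrightarrow> \<tau> = ?s n' (Suc k) y" for n' y
      proof -
        have "(?s n' k a)(B := y, A := 0, B := 0, A := y, K := Suc k) = ?s n' (Suc k) y"
          using \<sigma> by (auto simp: regs fun_eq_iff)
        then show ?thesis
          by (simp add: X_def in_relcomp in_clear in_move in_op_rel) (simp add: regs)
      qed
      show ?thesis
        unfolding L_def by (simp add: in_relcomp 0 S' 2 ex_image_conj)
    qed
    have pow: "(\<exists>y. rec_eval f ?xs y \<and> (?s n 0 y, \<tau>) \<in> L ^^ k) \<longleftrightarrow>
       k \<le> n \<and> (\<exists>y. rec_eval (PrimRec f g) (k # ?xs) y \<and> \<tau> = ?s (n - k) k y)" for n k \<tau>
    proof (induction k arbitrary: \<tau>)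
      case 0
      then show ?case by (auto simp: rec_eval_PrimRec_0)
    next
      case (Suc k)
      have "(\<exists>y. rec_eval f ?xs y \<and> (?s n 0 y, \<tau>) \<in> L ^^ Suc k) \<longleftrightarrow>
        (\<exists>\<rho>. (\<exists>y. rec_eval f ?xs y \<and> (?s n 0 y, \<rho>) \<in> L ^^ k) \<and> (\<rho>, \<tau>) \<in> L)"
        unfolding relpow.simps in_relcomp by blast
      also have "\<dots> \<longleftrightarrow> (k \<le> n \<and> (\<exists>y. rec_eval (PrimRec f g) (k # ?xs) y \<and> (?s (n - k) k y, \<tau>) \<in> L))"
        unfolding Suc by blast
      also have "\<dots> \<longleftrightarrow> Suc k \<le> n \<and>
          (\<exists>y. rec_eval (PrimRec f g) (Suc k # ?xs) y \<and> \<tau> = ?s (n - Suc k) (Suc k) y)"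
        unfolding L rec_eval_PrimRec_Suc by auto
      finally show ?case .
    qed
    have CR: "(\<sigma>, \<rho>) \<in> C O R \<longleftrightarrow> (\<exists>y. rec_eval f ?xs y \<and> \<rho> = ?s (\<sigma> r) 0 y)" for \<rho>
    proof -
      have "(\<sigma>(N := \<sigma> r), \<rho>) \<in> R \<longleftrightarrow> (\<exists>y. rec_eval f ?xs y \<and> \<rho> = \<sigma>(N := \<sigma> r, A := y))"
      proof -
        have A: "(\<sigma>(N := \<sigma> r)) A = 0" using \<sigma> by (simp add: regs)
        have "(\<sigma>(N := \<sigma> r), \<rho>) \<in> R \<longleftrightarrow> (\<exists>y. rec_eval f (map (\<sigma>(N := \<sigma> r)) rs) y \<and>
            \<rho> = \<sigma>(N := \<sigma> r, A := (\<sigma>(N := \<sigma> r)) A + y))"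
          by (rule implementsD[OF R]) (simp add: \<sigma> regs)
        then show ?thesis unfolding rs A by simp
      qed
      moreover have "\<sigma>(N := \<sigma> r, A := y) = ?s (\<sigma> r) 0 y" for y
        using \<sigma> by (auto simp: regs fun_eq_iff)
      moreover have "(\<sigma>, \<rho>') \<in> C \<longleftrightarrow> \<rho>' = \<sigma>(N := \<sigma> r)" for \<rho>'
        using C(2)[of \<sigma>] \<sigma> by (simp add: N_def)
      ultimately show ?thesis
        by (simp add: in_relcomp)
    qed
    have E: "(?s n k y, \<tau>) \<in> E \<longleftrightarrow> n = 0 \<and> \<tau> = \<sigma>(c := \<sigma> c + y)" for n k y
    proof -
      have "?s n k y N = n" "?s n k y A = y" "?s n k y c = \<sigma> c" "c \<noteq> A"
        using prems(2) by (auto simp: regs)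
      moreover have "(?s 0 k y)(A := 0, c := \<sigma> c + y, K := 0) = \<sigma>(c := \<sigma> c + y)"
        using prems(2) \<sigma> by (auto simp: regs fun_eq_iff)
      ultimately show ?thesis unfolding E_def in_relcomp in_op_rel in_move in_clear by auto
    qed
    have "(\<sigma>, \<tau>) \<in> (C O R) O L\<^sup>* O E \<longleftrightarrow>
        (\<exists>\<rho> k. (\<exists>y. rec_eval f ?xs y \<and> (?s (\<sigma> r) 0 y, \<rho>) \<in> L ^^ k) \<and> (\<rho>, \<tau>) \<in> E)"
      unfolding in_relcomp[of _ _ "C O R"] CR in_star_comp by blast
    also have "\<dots> \<longleftrightarrow> (\<exists>k\<le>\<sigma> r. \<exists>y. rec_eval (PrimRec f g) (k # ?xs) y \<and> (?s (\<sigma> r - k) k y, \<tau>) \<in> E)"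
      unfolding pow by blast
    also have "\<dots> \<longleftrightarrow> (\<exists>y. rec_eval (PrimRec f g) (\<sigma> r # ?xs) y \<and> \<tau> = \<sigma>(c := \<sigma> c + y))"
      unfolding E by (auto intro: le_antisym)
    finally show "(\<sigma>, \<tau>) \<in> (C O R) O L\<^sup>* O E \<longleftrightarrow>
        (\<exists>y. rec_eval (PrimRec f g) (map \<sigma> (r # rs)) y \<and> \<tau> = \<sigma>(c := \<sigma> c + y))"
      by simp
  qed
  then show ?thesis by blast
qed

lemma implementable_Mu:
  assumes IH: "\<And>rs c b. set rs \<subseteq> {..<b} \<Longrightarrow> c < b \<Longrightarrow> c \<notin> set rs \<Longrightarrow> \<exists>R. implements f rs c b R"
    and prems: "set rs \<subseteq> {..<b}" "c < b" "c \<notin> set rs"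
  shows "\<exists>R. implements (Mu f) rs c b R"
proof -
  define N V where "N = b" and "V = b + 1"
  note regs = N_def V_def
  have "\<exists>S. implements f (N # rs) V (b + 2) S"
    using prems by (intro IH) (auto simp: regs)
  then obtain S where S: "implements f (N # rs) V (b + 2) S" ..
  define L where "L = S O op_rel (Dec V) O clear V O op_rel (Inc N)"
  define E where "E = S O op_rel (Tst V) O move N c"
  have "implements (Mu f) rs c b (L\<^sup>* O E)"
    unfolding implements_def
  proof (intro conjI allI impI)
    show "flowchart (L\<^sup>* O E)"
      using S prems(2) unfolding L_def E_def
      by (intro flow_seq flow_star flow_op flow_move flow_clear) (auto simp: implements_def regs)
    fix \<sigma> \<tau> :: store assume \<sigma>: "\<forall>r\<ge>b. \<sigma> r = 0"
    let ?xs = "map \<sigma> rs"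
    have ne: "N \<noteq> V" "c \<noteq> N" "c \<noteq> V" using prems(2) by (auto simp: regs)
    have S': "(\<sigma>(N := n), \<rho>) \<in> S \<longleftrightarrow> (\<exists>y. rec_eval f (n # ?xs) y \<and> \<rho> = \<sigma>(N := n, V := y))" for n \<rho>
    proof -
      have "N \<notin> set rs" "(\<sigma>(N := n)) V = 0"
        using prems \<sigma> by (auto simp: regs)
      then show ?thesis
        using \<sigma> by (subst implementsD[OF S]) (simp add: regs, simp)
    qed
    have L: "(\<sigma>(N := n), \<rho>) \<in> L \<longleftrightarrow> (\<exists>y. rec_eval f (n # ?xs) (Suc y)) \<and> \<rho> = \<sigma>(N := Suc n)" for n \<rho>
    proof -
      have "\<sigma>(N := n, V := 0, N := Suc n) = \<sigma>(N := Suc n)"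
        using \<sigma> by (auto simp: regs fun_eq_iff)
      then have "(\<sigma>(N := n, V := y), \<rho>) \<in> op_rel (Dec V) O clear V O op_rel (Inc N) \<longleftrightarrow>
          y \<noteq> 0 \<and> \<rho> = \<sigma>(N := Suc n)" for y
        using ne by (simp add: in_relcomp in_op_rel in_clear)
      then show ?thesis
        unfolding L_def in_relcomp[of _ _ S] S' by (metis nat.distinct(1) not0_implies_Suc)
    qed
    have pow: "(\<sigma>, \<rho>) \<in> L ^^ k \<longleftrightarrow> (\<forall>i<k. \<exists>y. rec_eval f (i # ?xs) (Suc y)) \<and> \<rho> = \<sigma>(N := k)" for k \<rho>
    proof (induction k arbitrary: \<rho>)
      case 0
      have "\<sigma>(N := 0) = \<sigma>" using \<sigma> by (auto simp: N_def)
      then show ?case by auto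
    next
      case (Suc k)
      have "(\<sigma>, \<rho>) \<in> L ^^ Suc k \<longleftrightarrow> (\<forall>i<k. \<exists>y. rec_eval f (i # ?xs) (Suc y)) \<and> (\<sigma>(N := k), \<rho>) \<in> L"
        unfolding relpow.simps in_relcomp Suc by blast
      also have "\<dots> \<longleftrightarrow> (\<forall>i<Suc k. \<exists>y. rec_eval f (i # ?xs) (Suc y)) \<and> \<rho> = \<sigma>(N := Suc k)"
        unfolding L by (auto simp: less_Suc_eq)
      finally show ?case .
    qed
    have E: "(\<sigma>(N := k), \<tau>) \<in> E \<longleftrightarrow> rec_eval f (k # ?xs) 0 \<and> \<tau> = \<sigma>(c := \<sigma> c + k)" for k
    proof -
      have "\<sigma>(N := k, V := 0, N := 0, c := \<sigma> c + k) = \<sigma>(c := \<sigma> c + k)"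
        using \<sigma> ne by (auto simp: regs fun_eq_iff)
      then have 1: "(\<sigma>(N := k, V := y), \<tau>) \<in> op_rel (Tst V) O move N c \<longleftrightarrow>
          y = 0 \<and> \<tau> = \<sigma>(c := \<sigma> c + k)" for y
        using ne by (auto simp add: in_relcomp in_op_rel in_move)
      show ?thesis
        unfolding E_def in_relcomp[of _ _ S] S' ex_image_conj 1 by auto
    qed
    have "(\<sigma>, \<tau>) \<in> L\<^sup>* O E \<longleftrightarrow> (\<exists>k. (\<forall>i<k. \<exists>y. rec_eval f (i # ?xs) (Suc y)) \<and> (\<sigma>(N := k), \<tau>) \<in> E)"
      unfolding in_star_comp pow by blast
    also have "\<dots> \<longleftrightarrow> (\<exists>y. rec_eval (Mu f) ?xs y \<and> \<tau> = \<sigma>(c := \<sigma> c + y))"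
      unfolding E rec_eval_Mu by auto
    finally show "(\<sigma>, \<tau>) \<in> L\<^sup>* O E \<longleftrightarrow> \<dots>" .
  qed
  then show ?thesis by blast
qed

theorem implementable:
  "set rs \<subseteq> {..<b} \<Longrightarrow> c < b \<Longrightarrow> c \<notin> set rs \<Longrightarrow> \<exists>R. implements f rs c b R"
proof (induction f arbitrary: rs c b)
  case Zero
  show ?case by (rule exI[of _ Id]) (auto simp: implements_def flow_skip)
next
  case Succ
  show ?case
  proof (cases "\<exists>r. rs = [r]")
    case True
    then obtain r where r: "rs = [r]" by blast
    obtain R where "flowchart R"
      "\<And>\<sigma> \<tau>. \<sigma> b = 0 \<Longrightarrow> (\<sigma>, \<tau>) \<in> R \<longleftrightarrow> \<tau> = \<sigma>(c := \<sigma> c + \<sigma> r)"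
      using flow_copy[of r b c] Succ r by auto
    then have "implements Succ rs c b (R O op_rel (Inc c))"
      by (auto simp: implements_def r rec_eval_Succ in_relcomp in_op_rel intro: flowchart.intros)
    then show ?thesis by blast
  next
    case False
    then have "implements Succ rs c b {}"
      by (auto simp: implements_def rec_eval_Succ flow_fail)
    then show ?thesis by blast
  qed
next
  case (Proj i)
  show ?case
  proof (cases "i < length rs")
    case True
    then have "rs ! i < b" "rs ! i \<noteq> c"
      using Proj nth_mem by blast+
    then obtain R where "flowchart R"
      "\<And>\<sigma> \<tau>. \<sigma> b = 0 \<Longrightarrow> (\<sigma>, \<tau>) \<in> R \<longleftrightarrow> \<tau> = \<sigma>(c := \<sigma> c + \<sigma> (rs ! i))"
      using flow_copy[of "rs ! i" b c] Proj(2) by blast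
    then have "implements (Proj i) rs c b R"
      using True by (auto simp: implements_def rec_eval_Proj)
    then show ?thesis by blast
  next
    case False
    then have "implements (Proj i) rs c b {}"
      by (auto simp: implements_def rec_eval_Proj flow_fail)
    then show ?thesis by blast
  qed
next
  case (Comp f gs)
  show ?case
  proof (rule implementable_Comp[OF _ Comp.prems])
    fix h :: recf and rs' :: "nat list" and b' c' assume "h \<in> insert f (set gs)" and *: "set rs' \<subseteq> {..<b'}" "c' < b'" "c' \<notin> set rs'"
    then consider "h = f" | "h \<in> set gs" by blast
    then show "\<exists>R. implements h rs' c' b' R"
      by cases (simp_all add: Comp.IH *)
  qed
next
  case (PrimRec f g)
  show ?case
  proof (cases rs)
    case Nil
    then have "implements (PrimRec f g) rs c b {}"
      by (auto simp: implements_def rec_eval_PrimRec_Nil flow_fail)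
    then show ?thesis by blast
  next
    case (Cons r rs')
    show ?thesis
      unfolding Cons
    proof (rule implementable_PrimRec[OF _ PrimRec.prems[unfolded Cons]])
      fix h :: recf and rs' :: "nat list" and b' c' assume "h \<in> {f, g}" and *: "set rs' \<subseteq> {..<b'}" "c' < b'" "c' \<notin> set rs'"
      then consider "h = f" | "h = g" by blast
      then show "\<exists>R. implements h rs' c' b' R"
        by cases (simp_all add: PrimRec.IH *)
    qed
  qed
next
  case (Mu f)
  show ?case by (rule implementable_Mu[OF Mu.IH Mu.prems])
qed

section \<open>Counter machines\<close>

definition steps :: "(nat \<times> counter_op \<times> nat) set \<Rightarrow> (nat \<times> store) rel" where
  "steps \<Delta> = {((a, \<sigma>), (b, \<tau>)). \<exists>c. (a, c, b) \<in> \<Delta> \<and> (\<sigma>, \<tau>) \<in> op_rel c}"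

definition invariant :: "(nat \<times> counter_op \<times> nat) set \<Rightarrow> (nat \<Rightarrow> store set) \<Rightarrow> bool" where
  "invariant \<Delta> I \<longleftrightarrow> (\<forall>(a, c, b)\<in>\<Delta>. op_rel c `` I a \<subseteq> I b)"

lemma invariant_steps:
  assumes "invariant \<Delta> I" "((a, \<sigma>), (b, \<tau>)) \<in> (steps \<Delta>)\<^sup>*" "\<sigma> \<in> I a"
  shows "\<tau> \<in> I b"
  using assms(2,3)
proof (induction "(b, \<tau>)" arbitrary: b \<tau> rule: rtrancl_induct)
  case (step y)
  then show ?case using assms(1) by (cases y) (fastforce simp: steps_def invariant_def)
qed simp

lemma steps_mono: "\<Delta> \<subseteq> \<Delta>' \<Longrightarrow> (steps \<Delta>)\<^sup>* \<subseteq> (steps \<Delta>')\<^sup>*"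
  by (intro rtrancl_mono) (auto simp: steps_def)

lemma steps_edge: "(a, c, b) \<in> \<Delta> \<Longrightarrow> (\<sigma>, \<tau>) \<in> op_rel c \<Longrightarrow> ((a, \<sigma>), (b, \<tau>)) \<in> (steps \<Delta>)\<^sup>*"
  by (auto simp: steps_def)

lemma invariant_Un: "invariant (\<Delta>1 \<union> \<Delta>2) I \<longleftrightarrow> invariant \<Delta>1 I \<and> invariant \<Delta>2 I"
  by (auto simp: invariant_def ball_Un)

lemma invariant_cong:
  assumes "invariant \<Delta> I" "\<And>a c b. (a, c, b) \<in> \<Delta> \<Longrightarrow> J a = I a \<and> J b = I b"
  shows "invariant \<Delta> J"
  using assms unfolding invariant_def by fastforce

text \<open>Control states of the compiled machine are \<open>0\<close> and odd numbers; the even numbers are left for the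
  chain of transitions that loads the input.\<close>

definition fresh :: "nat \<Rightarrow> nat \<Rightarrow> nat set" where
  "fresh n n' = {2 * i + 1 | i. n \<le> i \<and> i < n'}"

text \<open>Soundness is stated through inductive invariants rather than paths: this survives the case
  \<open>s = t\<close>, which is needed for loops.\<close>

definition realizes :: "store rel \<Rightarrow> nat \<Rightarrow> nat \<Rightarrow> nat \<Rightarrow> (nat \<times> counter_op \<times> nat) set \<Rightarrow> nat \<Rightarrow> bool" where
  "realizes R s t n \<Delta> n' \<longleftrightarrow> n \<le> n' \<and> finite \<Delta> \<and>
     (\<forall>(a, c, b)\<in>\<Delta>. {a, b} \<subseteq> {s, t} \<union> fresh n n') \<and>
     (\<forall>(\<sigma>, \<tau>)\<in>R. ((s, \<sigma>), (t, \<tau>)) \<in> (steps \<Delta>)\<^sup>*) \<and>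
     (\<forall>I. R `` I s \<subseteq> I t \<longrightarrow> (\<exists>J. (\<forall>q. q \<notin> fresh n n' \<longrightarrow> J q = I q) \<and> invariant \<Delta> J))"

lemma realizesD:
  assumes "realizes R s t n \<Delta> n'"
  shows "n \<le> n'" "finite \<Delta>" "\<And>a c b. (a, c, b) \<in> \<Delta> \<Longrightarrow> {a, b} \<subseteq> {s, t} \<union> fresh n n'"
    "\<And>\<sigma> \<tau>. (\<sigma>, \<tau>) \<in> R \<Longrightarrow> ((s, \<sigma>), (t, \<tau>)) \<in> (steps \<Delta>)\<^sup>*"
    "\<And>I. R `` I s \<subseteq> I t \<Longrightarrow> \<exists>J. (\<forall>q. q \<notin> fresh n n' \<longrightarrow> J q = I q) \<and> invariant \<Delta> J"
proof -
  show "n \<le> n'" "finite \<Delta>" using assms by (simp_all add: realizes_def)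
  show "{a, b} \<subseteq> {s, t} \<union> fresh n n'" if "(a, c, b) \<in> \<Delta>" for a c b
  proof -
    have "\<forall>(a, c, b)\<in>\<Delta>. {a, b} \<subseteq> {s, t} \<union> fresh n n'"
      using assms unfolding realizes_def by (elim conjE)
    with that show ?thesis by fastforce
  qed
  show "((s, \<sigma>), (t, \<tau>)) \<in> (steps \<Delta>)\<^sup>*" if "(\<sigma>, \<tau>) \<in> R" for \<sigma> \<tau>
  proof -
    have "\<forall>(\<sigma>, \<tau>)\<in>R. ((s, \<sigma>), (t, \<tau>)) \<in> (steps \<Delta>)\<^sup>*"
      using assms unfolding realizes_def by (elim conjE)
    with that show ?thesis by fastforce
  qed
  show "\<exists>J. (\<forall>q. q \<notin> fresh n n' \<longrightarrow> J q = I q) \<and> invariant \<Delta> J" if "R `` I s \<subseteq> I t" for I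
    using assms that by (simp add: realizes_def)
qed

lemma fresh_mono: "n1 \<le> n2 \<Longrightarrow> n3 \<le> n4 \<Longrightarrow> fresh n2 n3 \<subseteq> fresh n1 n4"
  by (auto simp: fresh_def)

theorem flowchart_realized:
  assumes "flowchart R" "s \<notin> (\<Union>m. fresh n m)" "t \<notin> (\<Union>m. fresh n m)"
  shows "\<exists>\<Delta> n'. realizes R s t n \<Delta> n'"
  using assms
proof (induction arbitrary: s t n)
  case (flow_op c)
  have "realizes (op_rel c) s t n {(s, c, t)} n"
    unfolding realizes_def by (auto simp: steps_edge invariant_def)
  then show ?case by blast
next
  case (flow_seq R S)
  define m where "m = 2 * n + 1"
  have m: "m \<notin> fresh (Suc n) k" "m \<in> fresh n (Suc n)" for k
    by (auto simp: m_def fresh_def)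
  have s: "s \<notin> fresh k l" "t \<notin> fresh k l" if "n \<le> k" for k l
    using flow_seq.prems that by (auto simp: fresh_def)
  obtain \<Delta>1 n1 where 1: "realizes R s m (Suc n) \<Delta>1 n1"
    using flow_seq.IH(1)[of s "Suc n" m] s m by auto
  have le: "Suc n \<le> n1" by (rule realizesD[OF 1])
  have m': "m \<notin> fresh n1 k" for k
    using le by (auto simp: m_def fresh_def)
  obtain \<Delta>2 n2 where 2: "realizes S m t n1 \<Delta>2 n2"
    using flow_seq.IH(2)[of m n1 t] s m' le by auto
  have le2: "n1 \<le> n2" by (rule realizesD[OF 2])
  note sub = fresh_mono[of n "Suc n" n1 n2] fresh_mono[of n n1 n2 n2] fresh_mono[of n n "Suc n" n2]
  have disj: "fresh (Suc n) n1 \<inter> fresh n1 n2 = {}" by (auto simp: fresh_def)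
  have "realizes (R O S) s t n (\<Delta>1 \<union> \<Delta>2) n2"
    unfolding realizes_def
  proof (intro conjI ballI allI impI)
    show "n \<le> n2" using le le2 by simp
    show "finite (\<Delta>1 \<union> \<Delta>2)" using realizesD(2)[OF 1] realizesD(2)[OF 2] by simp
    show "case x of (a, c, b) \<Rightarrow> {a, b} \<subseteq> {s, t} \<union> fresh n n2" if "x \<in> \<Delta>1 \<union> \<Delta>2" for x
      using that realizesD(3)[OF 1] realizesD(3)[OF 2] m(2) sub le le2 by fastforce
    show "case x of (\<sigma>, \<tau>) \<Rightarrow> ((s, \<sigma>), t, \<tau>) \<in> (steps (\<Delta>1 \<union> \<Delta>2))\<^sup>*" if x: "x \<in> R O S" for x
    proof -
      obtain \<sigma> \<rho> \<tau> where "x = (\<sigma>, \<tau>)" "(\<sigma>, \<rho>) \<in> R" "(\<rho>, \<tau>) \<in> S" using x by auto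
      then have "((s, \<sigma>), (m, \<rho>)) \<in> (steps (\<Delta>1 \<union> \<Delta>2))\<^sup>*" "((m, \<rho>), (t, \<tau>)) \<in> (steps (\<Delta>1 \<union> \<Delta>2))\<^sup>*"
        using realizesD(4)[OF 1] realizesD(4)[OF 2] steps_mono[of \<Delta>1 "\<Delta>1 \<union> \<Delta>2"]
          steps_mono[of \<Delta>2 "\<Delta>1 \<union> \<Delta>2"] by blast+
      then show ?thesis using \<open>x = _\<close> by (auto intro: rtrancl_trans)
    qed
    fix I assume I: "(R O S) `` I s \<subseteq> I t"
    have sm: "s \<noteq> m" "t \<noteq> m" using s m by blast+
    obtain J1 where J1: "\<And>q. q \<notin> fresh (Suc n) n1 \<Longrightarrow> J1 q = (I(m := R `` I s)) q" "invariant \<Delta>1 J1"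
      using realizesD(5)[OF 1, of "I(m := R `` I s)"] sm by auto
    have J1': "J1 s = I s" "J1 t = I t" "J1 m = R `` I s"
      using J1(1) s m sm by auto
    obtain J2 where J2: "\<And>q. q \<notin> fresh n1 n2 \<Longrightarrow> J2 q = J1 q" "invariant \<Delta>2 J2"
      using realizesD(5)[OF 2, of J1] J1' I by (auto simp: relcomp_Image)
    have "J2 a = J1 a \<and> J2 b = J1 b" if "(a, c, b) \<in> \<Delta>1" for a c b
      using realizesD(3)[OF 1 that] J2(1) disj s[of n1 n2] m' le by auto
    then have "invariant (\<Delta>1 \<union> \<Delta>2) J2"
      using invariant_cong[OF J1(2), of J2] J2(2) by (simp add: invariant_Un)
    moreover have "J2 q = I q" if "q \<notin> fresh n n2" for q
      using that J1(1) J2(1) sub m(2) le le2 by (metis Suc_leD fun_upd_other in_mono le_SucI order_refl order_trans)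
    ultimately show "\<exists>J. (\<forall>q. q \<notin> fresh n n2 \<longrightarrow> J q = I q) \<and> invariant (\<Delta>1 \<union> \<Delta>2) J"
      by blast
  qed
  then show ?case by blast
next
  case (flow_star R)
  define m x y where "m = 2 * n + 1" and "x = 2 * n + 3" and "y = 2 * n + 5"
  have m: "m \<notin> fresh (n + 3) k" "x \<notin> fresh (n + 3) k" "y \<notin> fresh (n + 3) k"
    "{m, x, y} \<subseteq> fresh n (n + 3)" for k
    by (auto simp: m_def x_def y_def fresh_def) presburger+
  have s: "s \<notin> fresh k l" "t \<notin> fresh k l" if "n \<le> k" for k l
    using flow_star.prems that by (auto simp: fresh_def)
  obtain \<Delta>1 n1 where 1: "realizes R m m (n + 3) \<Delta>1 n1"
    using flow_star.IH[of m "n + 3" m] m by auto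
  have le: "n + 3 \<le> n1" by (rule realizesD[OF 1])
  note sub = fresh_mono[of n "n + 3" n1 n1] fresh_mono[of n n "n + 3" n1]
  have ne: "s \<notin> {m, x, y}" "t \<notin> {m, x, y}" "m \<noteq> x" "m \<noteq> y" "x \<noteq> y"
    using s[of n "n + 3"] m(4) by (auto simp: m_def x_def y_def)
  let ?E = "{(s, Inc 0, x), (x, Dec 0, m), (m, Inc 0, y), (y, Dec 0, t)}"
  have "realizes (R\<^sup>*) s t n (\<Delta>1 \<union> ?E) n1"
    unfolding realizes_def
  proof (intro conjI ballI allI impI)
    show "n \<le> n1" using le by simp
    show "finite (\<Delta>1 \<union> ?E)" using realizesD(2)[OF 1] by simp
    show "case e of (a, c, b) \<Rightarrow> {a, b} \<subseteq> {s, t} \<union> fresh n n1" if "e \<in> \<Delta>1 \<union> ?E" for e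
      using that realizesD(3)[OF 1] m(4) sub le by fastforce
    show "case p of (\<sigma>, \<tau>) \<Rightarrow> ((s, \<sigma>), t, \<tau>) \<in> (steps (\<Delta>1 \<union> ?E))\<^sup>*" if p: "p \<in> R\<^sup>*" for p
    proof -
      obtain \<sigma> \<tau> where p': "p = (\<sigma>, \<tau>)" by fastforce
      have skip: "((a, \<rho>), (b, \<rho>)) \<in> (steps \<Delta>)\<^sup>*"
        if "(a, Inc 0, c) \<in> \<Delta>" "(c, Dec 0, b) \<in> \<Delta>" for a b c \<rho> \<Delta>
        using steps_edge[OF that(1), of \<rho> "\<rho>(0 := Suc (\<rho> 0))"]
          steps_edge[OF that(2), of "\<rho>(0 := Suc (\<rho> 0))" \<rho>]
        by (auto simp: in_op_rel intro: rtrancl_trans)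
      have "(\<sigma>, \<tau>) \<in> R\<^sup>*" using p p' by simp
      then have "((m, \<sigma>), (m, \<tau>)) \<in> (steps (\<Delta>1 \<union> ?E))\<^sup>*"
      proof induction
        case (step \<rho> \<rho>')
        have "((m, \<rho>), (m, \<rho>')) \<in> (steps (\<Delta>1 \<union> ?E))\<^sup>*"
          using realizesD(4)[OF 1 step(2)] steps_mono[of \<Delta>1 "\<Delta>1 \<union> ?E"] by blast
        with step(3) show ?case by (rule rtrancl_trans)
      qed simp
      moreover have "((s, \<sigma>), (m, \<sigma>)) \<in> (steps (\<Delta>1 \<union> ?E))\<^sup>*"
        by (rule skip[of _ x]) auto
      moreover have "((m, \<tau>), (t, \<tau>)) \<in> (steps (\<Delta>1 \<union> ?E))\<^sup>*"
        by (rule skip[of _ y]) auto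
      ultimately show ?thesis using p' by (auto intro: rtrancl_trans)
    qed
    fix I assume I: "R\<^sup>* `` I s \<subseteq> I t"
    define I' where "I' = I(m := R\<^sup>* `` I s, x := op_rel (Inc 0) `` I s, y := op_rel (Inc 0) `` (R\<^sup>* `` I s))"
    have "R `` I' m \<subseteq> I' m"
      using ne by (auto simp: I'_def intro: rtrancl_into_rtrancl)
    then obtain J where J: "\<And>q. q \<notin> fresh (n + 3) n1 \<Longrightarrow> J q = I' q" "invariant \<Delta>1 J"
      using realizesD(5)[OF 1] by blast
    have J': "J s = I s" "J t = I t" "J m = R\<^sup>* `` I s" "J x = op_rel (Inc 0) `` I s"
      "J y = op_rel (Inc 0) `` (R\<^sup>* `` I s)"
      using J(1) s m ne by (auto simp: I'_def)
    have "op_rel (Dec 0) `` (op_rel (Inc 0) `` A) = A" for A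
      by (simp add: Inc_Dec_Id flip: relcomp_Image)
    then have "invariant (\<Delta>1 \<union> ?E) J"
      using J(2) I by (auto simp: invariant_def J')
    moreover have "J q = I q" if "q \<notin> fresh n n1" for q
    proof -
      have "q \<notin> fresh (n + 3) n1" "q \<notin> {m, x, y}"
        using that sub le m(4) by auto
      then show ?thesis using J(1) by (simp add: I'_def)
    qed
    ultimately show "\<exists>J. (\<forall>q. q \<notin> fresh n n1 \<longrightarrow> J q = I q) \<and> invariant (\<Delta>1 \<union> ?E) J"
      by blast
  qed
  then show ?case by blast
qed

definition load :: "nat \<Rightarrow> (nat \<times> counter_op \<times> nat) set" where
  "load n = (\<lambda>j. (2 * j + 2, Inc 0, 2 * j)) ` {..<n}"

lemma load_steps: "j \<le> n \<Longrightarrow> ((2 * j, (\<lambda>_. 0)(0 := k)), (0, (\<lambda>_. 0)(0 := k + j))) \<in> (steps (load n))\<^sup>*"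
proof (induction j arbitrary: k)
  case (Suc j)
  have "((2 * j + 2, (\<lambda>_. 0)(0 := k)), (2 * j, (\<lambda>_. 0)(0 := Suc k))) \<in> (steps (load n))\<^sup>*"
    by (rule steps_edge[of _ "Inc 0"]) (use Suc.prems in \<open>auto simp: load_def in_op_rel\<close>)
  also have "((2 * j, (\<lambda>_. 0)(0 := Suc k)), (0, (\<lambda>_. 0)(0 := Suc k + j))) \<in> (steps (load n))\<^sup>*"
    by (rule Suc.IH) (use Suc.prems in simp)
  finally show ?case by (simp add: fun_upd_def)
qed simp

theorem machine_for_recf:
  obtains \<Delta> where "finite \<Delta>" "\<And>a c b. (a, c, b) \<in> \<Delta> \<Longrightarrow> a = 0 \<or> odd a"
    "\<And>n. ((2 * n, \<lambda>_. 0), (1, \<lambda>_. 0)) \<in> (steps (\<Delta> \<union> load n))\<^sup>* \<longleftrightarrow> rec_eval f [n] 0"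
proof -
  obtain R where R: "implements f [0] 1 2 R"
    using implementable[of "[0]" 2 1 f] by auto
  define Q where "Q = R O op_rel (Tst 1) O clear 0"
  have Q: "((\<lambda>_. 0)(0 := n), \<lambda>_. 0) \<in> Q \<longleftrightarrow> rec_eval f [n] 0" for n
  proof -
    let ?\<sigma> = "(\<lambda>_. 0)(0 := n) :: store"
    have 1: "(?\<sigma>, \<rho>) \<in> R \<longleftrightarrow> (\<exists>y. rec_eval f [n] y \<and> \<rho> = ?\<sigma>(1 := y))" for \<rho>
      by (subst implementsD[OF R]) auto
    have 2: "(?\<sigma>(1 := y), \<lambda>_. 0) \<in> op_rel (Tst 1) O clear 0 \<longleftrightarrow> y = 0" for y
    proof -
      have "(?\<sigma>(1 := y), \<lambda>_. 0) \<in> op_rel (Tst 1) O clear 0 \<longleftrightarrow> y = 0 \<and> (\<lambda>_. 0) = ?\<sigma>(1 := y, 0 := 0)"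
        unfolding in_relcomp in_op_rel in_clear by auto
      then show ?thesis by auto
    qed
    show ?thesis
      unfolding Q_def in_relcomp[of _ _ R] 1 ex_image_conj 2 by auto
  qed
  have "flowchart Q"
    using R unfolding Q_def implements_def by (intro flow_seq flow_op flow_clear) simp
  then obtain \<Delta> n' where \<Delta>: "realizes Q 0 1 1 \<Delta> n'"
    using flowchart_realized[of Q 0 1 1] by (auto simp: fresh_def)
  have iff: "((2 * n, \<lambda>_. 0), (1, \<lambda>_. 0)) \<in> (steps (\<Delta> \<union> load n))\<^sup>* \<longleftrightarrow> rec_eval f [n] 0" for n
  proof
    assume *: "((2 * n, \<lambda>_. 0), (1, \<lambda>_. 0)) \<in> (steps (\<Delta> \<union> load n))\<^sup>*"
    define I where "I q = (if q = 1 then Q `` {(\<lambda>_. 0)(0 := n)}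
      else if even q then {(\<lambda>_. 0)(0 := n - q div 2)} else {})" for q :: nat
    have "Q `` I 0 \<subseteq> I 1" by (auto simp: I_def)
    then obtain J where J: "\<And>q. q \<notin> fresh 1 n' \<Longrightarrow> J q = I q" "invariant \<Delta> J"
      using realizesD(5)[OF \<Delta>, of I] by blast
    have ev: "J (2 * q) = {(\<lambda>_. 0)(0 := n - q)}" for q
    proof -
      have "2 * q \<notin> fresh 1 n'" by (auto simp: fresh_def) presburger
      then show ?thesis using J(1) by (simp add: I_def)
    qed
    have "invariant (load n) J"
      unfolding invariant_def load_def
    proof clarify
      fix j \<sigma> \<tau> assume j: "j < n" and "\<sigma> \<in> J (2 * j + 2)" "(\<sigma>, \<tau>) \<in> op_rel (Inc 0)"
      moreover have "J (2 * j + 2) = {(\<lambda>_. 0)(0 := n - Suc j)}"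
        using ev[of "Suc j"] by simp
      moreover have "n - j = Suc (n - Suc j)" using j by simp
      ultimately show "\<tau> \<in> J (2 * j)"
        by (simp add: ev in_op_rel)
    qed
    with J(2) have "invariant (\<Delta> \<union> load n) J"
      by (simp add: invariant_Un)
    moreover have "(\<lambda>_. 0) \<in> J (2 * n)" unfolding ev by auto
    ultimately have "(\<lambda>_. 0) \<in> J 1"
      using * invariant_steps by blast
    moreover have "J 1 = Q `` {(\<lambda>_. 0)(0 := n)}"
      using J(1)[of 1] by (auto simp: I_def fresh_def)
    ultimately show "rec_eval f [n] 0" using Q by auto
  next
    assume "rec_eval f [n] 0"
    then have "((0, (\<lambda>_. 0)(0 := n)), (1, \<lambda>_. 0)) \<in> (steps \<Delta>)\<^sup>*"
      using realizesD(4)[OF \<Delta>] Q by blast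
    moreover have "((2 * n, \<lambda>_. 0), (0, (\<lambda>_. 0)(0 := n))) \<in> (steps (load n))\<^sup>*"
      using load_steps[of n n 0] by (simp add: fun_upd_idem)
    ultimately show "((2 * n, \<lambda>_. 0), (1, \<lambda>_. 0)) \<in> (steps (\<Delta> \<union> load n))\<^sup>*"
      using steps_mono[of \<Delta> "\<Delta> \<union> load n"] steps_mono[of "load n" "\<Delta> \<union> load n"]
      by (meson UnCI in_mono rtrancl_trans subsetI)
  qed
  have src: "a = 0 \<or> odd a" if "(a, c, b) \<in> \<Delta>" for a c b
    using realizesD(3)[OF \<Delta> that] by (auto simp: fresh_def)
  show thesis
  proof (rule that)
    show "finite \<Delta>" by (rule realizesD[OF \<Delta>])
  qed (fact src iff)+
qed

section \<open>Counter operations as cMSCs\<close>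

fun register :: "counter_op \<Rightarrow> nat" where
  "register (Inc r) = r" | "register (Dec r) = r" | "register (Tst r) = r"

text \<open>The counter \<open>r\<close> is the number of messages pending on the channel from process \<open>0\<close> to process
  \<open>Suc r\<close>. A matched message can only be appended if no message is pending on its channel, because an
  unmatched send must not precede a matched one: this is the zero test. The first argument is the
  number of the first event.\<close>

fun op_cmsc :: "nat \<Rightarrow> counter_op \<Rightarrow> nat_cmsc" where
  "op_cmsc n (Inc r) = \<lparr>events = {n}, leq = {(n, n)}, msg = {},
     label = (\<lambda>_. undefined)(n := Send 0 (Suc r)), content = [n \<mapsto> 0]\<rparr>"
| "op_cmsc n (Dec r) = \<lparr>events = {n}, leq = {(n, n)}, msg = {},
     label = (\<lambda>_. undefined)(n := Recv (Suc r) 0), content = [n \<mapsto> 0]\<rparr>"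
| "op_cmsc n (Tst r) = \<lparr>events = {n, Suc n}, leq = {(n, n), (n, Suc n), (Suc n, Suc n)},
     msg = {(n, Suc n)},
     label = (\<lambda>_. undefined)(n := Send 0 (Suc r), Suc n := Recv (Suc r) 0), content = Map.empty\<rparr>"

lemma op_cmsc_sel [simp]:
  "events (op_cmsc n (Inc r)) = {n}" "events (op_cmsc n (Dec r)) = {n}" "events (op_cmsc n (Tst r)) = {n, Suc n}"
  "leq (op_cmsc n (Inc r)) = {(n, n)}" "leq (op_cmsc n (Dec r)) = {(n, n)}"
  "leq (op_cmsc n (Tst r)) = {(n, n), (n, Suc n), (Suc n, Suc n)}"
  "msg (op_cmsc n (Inc r)) = {}" "msg (op_cmsc n (Dec r)) = {}" "msg (op_cmsc n (Tst r)) = {(n, Suc n)}"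
  "label (op_cmsc n (Inc r)) = (\<lambda>_. undefined)(n := Send 0 (Suc r))"
  "label (op_cmsc n (Dec r)) = (\<lambda>_. undefined)(n := Recv (Suc r) 0)"
  "label (op_cmsc n (Tst r)) = (\<lambda>_. undefined)(n := Send 0 (Suc r), Suc n := Recv (Suc r) 0)"
  "content (op_cmsc n (Inc r)) = [n \<mapsto> 0]" "content (op_cmsc n (Dec r)) = [n \<mapsto> 0]"
  "content (op_cmsc n (Tst r)) = Map.empty"
  "unm (op_cmsc n (Inc r)) = {n}" "unm (op_cmsc n (Dec r)) = {n}" "unm (op_cmsc n (Tst r)) = {}"
  by (auto simp: unm_def)

declare op_cmsc.simps [simp del]

text \<open>All cMSCs built below have their events numbered in an order compatible with the causal order,
  so that each process order is the restriction of the numerical order.\<close>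

definition numeric_leq :: "nat set \<Rightarrow> nat set \<Rightarrow> (nat \<Rightarrow> nat act) \<Rightarrow> nat \<Rightarrow> nat rel" where
  "numeric_leq P E l p = {(e, f). e \<in> E \<and> f \<in> E \<and> l e \<in> Act_of P p \<and> l f \<in> Act_of P p \<and> e \<le> f}"

definition closure_leq :: "nat set \<Rightarrow> nat set \<Rightarrow> (nat \<Rightarrow> nat act) \<Rightarrow> nat rel \<Rightarrow> nat rel" where
  "closure_leq P E l m = Restr (((\<Union>p\<in>P. covering (numeric_leq P E l p)) \<union> m)\<^sup>*) E"

lemma Send_in_Act_of [simp]: "Send a b \<in> Act_of P p \<longleftrightarrow> a = p \<and> (a, b) \<in> Ch P"
  by (auto simp: Act_of_def)

lemma Recv_in_Act_of [simp]: "Recv a b \<in> Act_of P p \<longleftrightarrow> a = p \<and> (b, a) \<in> Ch P"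
  by (auto simp: Act_of_def)

lemma Act_iff: "l \<in> Act P \<longleftrightarrow> (\<exists>p\<in>P. l \<in> Act_of P p)"
  by (auto simp: Act_def)

locale numbered =
  fixes P :: "nat set" and M :: nat_cmsc
  assumes finite_events: "finite (events M)" and nonempty: "events M \<noteq> {}"
    and label: "label M \<in> events M \<rightarrow>\<^sub>E Act P"
    and msg_less: "(e, f) \<in> msg M \<Longrightarrow> e < f \<and> e \<in> events M \<and> f \<in> events M"
    and msg_label: "(e, f) \<in> msg M \<Longrightarrow>
      \<exists>p q. (p, q) \<in> Ch P \<and> label M e = Send p q \<and> label M f = Recv q p"
    and fifo: "(e, f) \<in> msg M \<Longrightarrow> (e', f') \<in> msg M \<Longrightarrow> label M e = label M e' \<Longrightarrow> e \<le> e' \<longleftrightarrow> f \<le> f'"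
    and leq: "leq M = closure_leq P (events M) (label M) (msg M)"
    and dom_content: "dom (content M) = unm M" and ran_content: "ran (content M) \<subseteq> {0}"
    and unm_send: "(e, f) \<in> msg M \<Longrightarrow> g \<in> unm M \<Longrightarrow> label M g = label M e \<Longrightarrow> e < g"
    and unm_recv: "(e, f) \<in> msg M \<Longrightarrow> g \<in> unm M \<Longrightarrow> label M g = label M f \<Longrightarrow> g < f"
begin

lemma leq_le: "(e, f) \<in> leq M \<Longrightarrow> e \<le> f"
proof -
  let ?r = "(\<Union>p\<in>P. covering (numeric_leq P (events M) (label M) p)) \<union> msg M"
  have sub: "a \<le> b" if "(a, b) \<in> ?r" for a b
    using that msg_less by (fastforce simp: covering_def numeric_leq_def)
  have "e \<le> f" if "(e, f) \<in> ?r\<^sup>*"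
    using that
  proof induction
    case (step y z)
    then show ?case using sub[of y z] by simp
  qed simp
  then show "(e, f) \<in> leq M \<Longrightarrow> e \<le> f" by (simp add: leq closure_leq_def)
qed

lemma numeric_leq_subset_leq:
  assumes "p \<in> P"
  shows "numeric_leq P (events M) (label M) p \<subseteq> leq M"
proof clarify
  fix e f assume "(e, f) \<in> numeric_leq P (events M) (label M) p"
  let ?r = "(\<Union>p\<in>P. covering (numeric_leq P (events M) (label M) p)) \<union> msg M"
  have "(e, f) \<in> numeric_leq P (events M) (label M) p \<Longrightarrow> (e, f) \<in> ?r\<^sup>*"
  proof (induction "f - e" arbitrary: e rule: less_induct)
    case less
    then have ef: "e \<in> events M" "f \<in> events M" "label M e \<in> Act_of P p" "label M f \<in> Act_of P p" "e \<le> f"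
      by (auto simp: numeric_leq_def)
    show ?case
    proof (cases "e = f")
      case False
      let ?X = "{x \<in> events M. label M x \<in> Act_of P p \<and> e < x}"
      define x where "x = Min ?X"
      have X: "finite ?X" "f \<in> ?X" using ef False finite_events by auto
      then have x: "x \<in> ?X" "x \<le> f" unfolding x_def using Min_in[of ?X] Min_le[of ?X f] by blast+
      have min: "x \<le> y" if "y \<in> ?X" for y using X(1) that by (simp add: x_def)
      have "(e, x) \<in> covering (numeric_leq P (events M) (label M) p)"
        using x(1) ef min by (fastforce simp: covering_def numeric_leq_def)
      moreover have "(x, f) \<in> ?r\<^sup>*"
      proof (rule less.hyps)
        show "f - x < f - e" using x by auto
        show "(x, f) \<in> numeric_leq P (events M) (label M) p" using x ef by (auto simp: numeric_leq_def)
      qed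
      ultimately show ?thesis
        using assms by (meson UN_I UnI1 converse_rtrancl_into_rtrancl)
    qed simp
  qed
  then show "(e, f) \<in> leq M"
    using \<open>(e, f) \<in> numeric_leq P (events M) (label M) p\<close> by (auto simp: leq closure_leq_def numeric_leq_def)
qed

lemma proc_leq_eq: "p \<in> P \<Longrightarrow> proc_leq P M p = numeric_leq P (events M) (label M) p"
  using numeric_leq_subset_leq[of p] leq_le
  by (auto simp: proc_leq_def proc_events_def numeric_leq_def)

lemma fcMSC: "M \<in> fcMSC P {0}"
proof -
  have po: "partial_order_on (events M) (leq M)"
    unfolding partial_order_on_def preorder_on_def
  proof (intro conjI)
    show "leq M \<subseteq> events M \<times> events M" "refl_on (events M) (leq M)"
      by (auto simp: leq closure_leq_def refl_on_def)
    show "trans (leq M)"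
      by (auto simp: leq closure_leq_def intro!: transI)
    show "antisym (leq M)"
      using leq_le by (auto intro!: antisymI le_antisym)
  qed
  have lin: "linear_order_on (proc_events P M p) (proc_leq P M p)" if "p \<in> P" for p
    unfolding proc_leq_eq[OF that]
    by (auto simp: order_on_defs refl_on_def total_on_def numeric_leq_def proc_events_def
        intro!: transI antisymI)
  have covers: "leq M = Restr ((proc_succ P M \<union> msg M)\<^sup>*) (events M)"
    using proc_leq_eq by (simp add: leq closure_leq_def proc_succ_def)
  have send: "(e, g) \<in> leq M" if "e \<in> events M" "g \<in> events M" "label M g = label M e" "e < g" for e g
  proof -
    have "label M e \<in> Act P" using label that by (auto simp: PiE_def)
    then obtain p where "p \<in> P" "label M e \<in> Act_of P p" by (auto simp: Act_iff)
    then show ?thesis using numeric_leq_subset_leq[of p] that by (auto simp: numeric_leq_def)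
  qed
  have msg_leq: "msg M \<subseteq> leq M"
    using msg_less by (auto simp: leq closure_leq_def)
  have fifo': "(e, e') \<in> proc_leq P M p \<longleftrightarrow> (f, f') \<in> proc_leq P M q"
    if "p \<in> P" "q \<in> P" "(e, f) \<in> msg M" "(e', f') \<in> msg M" "e \<in> proc_events P M p"
      "e' \<in> proc_events P M p" "f \<in> proc_events P M q" "f' \<in> proc_events P M q" for p q e f e' f'
  proof -
    have "label M e = label M e'"
      using msg_label[OF that(3)] msg_label[OF that(4)] that(5-8) by (auto simp: proc_events_def)
    then have "e \<le> e' \<longleftrightarrow> f \<le> f'" using fifo that(3,4) by blast
    then show ?thesis
      using that by (auto simp: proc_leq_eq numeric_leq_def proc_events_def)
  qed
  have unm_events: "unm M \<subseteq> events M" by (auto simp: unm_def)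
  have "M \<in> cMSC P {0}"
    unfolding cMSC_def
  proof (intro CollectI conjI)
    show "\<forall>p\<in>P. linear_order_on (proc_events P M p) (proc_leq P M p) \<and>
        (finite (proc_events P M p) \<or> order_iso_nat (proc_events P M p) (proc_leq P M p))"
      using lin finite_events by (simp add: proc_events_def)
    show "\<forall>(e, f)\<in>msg M. \<exists>(p, q)\<in>Ch P. label M e = Send p q \<and> label M f = Recv q p"
      using msg_label by fast
    show "\<forall>p\<in>P. \<forall>q\<in>P. \<forall>(e, f)\<in>msg M. \<forall>(e', f')\<in>msg M.
        e \<in> proc_events P M p \<and> e' \<in> proc_events P M p \<and>
        f \<in> proc_events P M q \<and> f' \<in> proc_events P M q \<longrightarrow>
        ((e, e') \<in> proc_leq P M p \<longleftrightarrow> (f, f') \<in> proc_leq P M q)"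
      using fifo' by fast
    show "\<forall>(e, f)\<in>msg M. \<forall>g\<in>unm M.
        (label M g = label M e \<longrightarrow> (e, g) \<in> leq M \<and> e \<noteq> g) \<and>
        (label M g = label M f \<longrightarrow> (g, f) \<in> leq M \<and> g \<noteq> f)"
    proof clarify
      fix e f g assume ef: "(e, f) \<in> msg M" and g: "g \<in> unm M"
      have ev: "e \<in> events M" "f \<in> events M" "g \<in> events M"
        using msg_less[OF ef] g unm_events by auto
      show "(label M g = label M e \<longrightarrow> (e, g) \<in> leq M \<and> e \<noteq> g) \<and>
        (label M g = label M f \<longrightarrow> (g, f) \<in> leq M \<and> g \<noteq> f)"
        using send[of e g] send[of g f] unm_send[OF ef g] unm_recv[OF ef g] ev by auto
    qed
  qed (fact nonempty po label msg_leq covers dom_content ran_content)+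
  then show ?thesis using finite_events by (simp add: fcMSC_def)
qed

lemma content_unm:
  assumes "e \<in> unm M"
  shows "content M e = Some 0"
proof -
  obtain x where x: "content M e = Some x" using assms dom_content by blast
  then have "x \<in> {0}" using ran_content ranI by fast
  with x show ?thesis by simp
qed

end

lemma covering_Id: "r \<subseteq> Id \<Longrightarrow> covering r = {}"
  by (auto simp: covering_def)

lemma numbered_op_cmsc:
  assumes "0 \<in> P" "Suc (register c) \<in> P"
  shows "numbered P (op_cmsc n c)"
proof
  have ch: "(0, Suc (register c)) \<in> Ch P" using assms by (auto simp: Ch_def)
  have act: "Send 0 (Suc (register c)) \<in> Act P" "Recv (Suc (register c)) 0 \<in> Act P"
    using assms ch by (auto simp: Act_iff)
  show "finite (events (op_cmsc n c))" "events (op_cmsc n c) \<noteq> {}"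
    by (cases c; simp)+
  show "label (op_cmsc n c) \<in> events (op_cmsc n c) \<rightarrow>\<^sub>E Act P"
    using act by (cases c) (auto simp: PiE_iff extensional_def)
  show "e < f \<and> e \<in> events (op_cmsc n c) \<and> f \<in> events (op_cmsc n c)" if "(e, f) \<in> msg (op_cmsc n c)" for e f
    using that by (cases c) auto
  show "\<exists>p q. (p, q) \<in> Ch P \<and> label (op_cmsc n c) e = Send p q \<and> label (op_cmsc n c) f = Recv q p"
    if "(e, f) \<in> msg (op_cmsc n c)" for e f
    using that ch by (cases c) auto
  show "(e \<le> e') = (f \<le> f')" if "(e, f) \<in> msg (op_cmsc n c)" "(e', f') \<in> msg (op_cmsc n c)" for e f e' f'
    using that by (cases c) auto
  show "dom (content (op_cmsc n c)) = unm (op_cmsc n c)"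
    by (cases c) simp_all
  show "ran (content (op_cmsc n c)) \<subseteq> {0}"
    by (cases c) simp_all
  show "e < g" if "(e, f) \<in> msg (op_cmsc n c)" "g \<in> unm (op_cmsc n c)" for e f g
    using that by (cases c) auto
  show "g < f" if "(e, f) \<in> msg (op_cmsc n c)" "g \<in> unm (op_cmsc n c)" for e f g
    using that by (cases c) auto
  have "numeric_leq P (events (op_cmsc n c)) (label (op_cmsc n c)) p \<subseteq> Id" for p
    by (cases c) (auto simp: numeric_leq_def)
  then have "closure_leq P (events (op_cmsc n c)) (label (op_cmsc n c)) (msg (op_cmsc n c)) =
      Restr ((msg (op_cmsc n c))\<^sup>*) (events (op_cmsc n c))"
    by (simp add: closure_leq_def covering_Id)
  also have "\<dots> = leq (op_cmsc n c)"
  proof -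
    have "{(n, Suc n)}\<^sup>* = Id \<union> {(n, Suc n)}"
      by (subst rtrancl_trancl_reflcl, subst trancl_id) (auto intro: transI)
    then show ?thesis by (cases c) auto
  qed
  finally show "leq (op_cmsc n c) = closure_leq P (events (op_cmsc n c)) (label (op_cmsc n c)) (msg (op_cmsc n c))" ..
qed

definition join :: "nat set \<Rightarrow> nat_cmsc \<Rightarrow> nat_cmsc \<Rightarrow> nat rel \<Rightarrow> nat_cmsc" where
  "join P M N new =
    (let E = events M \<union> events N; l = (\<lambda>e. if e \<in> events N then label N e else label M e);
         m = msg M \<union> msg N \<union> new
     in \<lparr>events = E, leq = closure_leq P E l m, msg = m, label = l,
         content = (\<lambda>e. if e \<in> E \<and> (\<forall>f. (e, f) \<notin> m \<and> (f, e) \<notin> m) then Some 0 else None)\<rparr>)"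

text \<open>Appending \<open>N\<close> to \<open>M\<close> with at most one new message. The assumption \<open>tested\<close> is where the zero test
  is enforced.\<close>

locale joinable = M: numbered P M + N: numbered P N
  for P :: "nat set" and M N :: nat_cmsc +
  fixes new :: "nat rel"
  assumes before: "e \<in> events M \<Longrightarrow> f \<in> events N \<Longrightarrow> e < f"
    and new_unm: "(e, f) \<in> new \<Longrightarrow> e \<in> unm M \<and> f \<in> unm N"
    and new_label: "(e, f) \<in> new \<Longrightarrow>
      \<exists>p q. (p, q) \<in> Ch P \<and> label M e = Send p q \<and> label N f = Recv q p"
    and new_unique: "x \<in> new \<Longrightarrow> y \<in> new \<Longrightarrow> x = y"
    and new_first: "(e, f) \<in> new \<Longrightarrow> g \<in> unm M \<Longrightarrow> label M g = label M e \<Longrightarrow> e \<le> g"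
    and unm_right: "g \<in> unm N \<Longrightarrow> g \<notin> Range new \<Longrightarrow> \<exists>p q. label N g = Send p q"
    and tested: "(e, f) \<in> msg N \<Longrightarrow> g \<in> unm M \<Longrightarrow> label M g \<noteq> label N e"
begin

abbreviation "J \<equiv> join P M N new"

lemma join_simps:
  "events J = events M \<union> events N" "msg J = msg M \<union> msg N \<union> new"
  by (simp_all add: join_def Let_def)

lemma disjoint: "e \<in> events M \<Longrightarrow> e \<notin> events N"
  using before by blast

lemma label_join: "e \<in> events M \<Longrightarrow> label J e = label M e" "e \<in> events N \<Longrightarrow> label J e = label N e"
  using disjoint by (simp_all add: join_def Let_def)

lemma unm_sub: "unm M \<subseteq> events M" "unm N \<subseteq> events N"
  by (auto simp: unm_def)

lemma new_events: "(e, f) \<in> new \<Longrightarrow> e \<in> events M \<and> f \<in> events N"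
  using new_unm unm_sub by blast

lemma unm_join: "unm J = (unm M - Domain new) \<union> (unm N - Range new)"
proof -
  have "e \<in> unm J \<longleftrightarrow> e \<in> (unm M - Domain new) \<union> (unm N - Range new)" for e
    unfolding unm_def join_simps
    using M.msg_less N.msg_less new_events disjoint by blast
  then show ?thesis by blast
qed

lemma msg_join_cases:
  assumes "(e, f) \<in> msg J"
  obtains (M) "(e, f) \<in> msg M" "e \<in> events M" "f \<in> events M" "label J e = label M e" "label J f = label M f"
  | (N) "(e, f) \<in> msg N" "e \<in> events N" "f \<in> events N" "label J e = label N e" "label J f = label N f"
  | (new) "(e, f) \<in> new" "e \<in> events M" "f \<in> events N" "label J e = label M e" "label J f = label N f"
  using assms M.msg_less[of e f] N.msg_less[of e f] new_events[of e f] label_join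
  unfolding join_simps by blast

lemma unm_join_cases:
  assumes "g \<in> unm J"
  obtains (M) "g \<in> unm M" "g \<in> events M" "g \<notin> Domain new" "label J g = label M g"
  | (N) "g \<in> unm N" "g \<in> events N" "g \<notin> Range new" "label J g = label N g"
  using assms unm_sub label_join unfolding unm_join by blast

lemma new_label_neq:
  assumes "(a, b) \<in> new" "(e, f) \<in> msg N" shows "label M a \<noteq> label N e"
  using tested assms new_unm by blast

lemma fifo_join:
  assumes "(e, f) \<in> msg J" "(e', f') \<in> msg J" "label J e = label J e'"
  shows "e \<le> e' \<longleftrightarrow> f \<le> f'"
  using assms(1)
proof (cases rule: msg_join_cases)
  case 1: M
  from assms(2) show ?thesis
  proof (cases rule: msg_join_cases)
    case M
    then show ?thesis using 1 assms(3) M.fifo by simp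
  next
    case N
    then show ?thesis using 1 before by (simp add: less_imp_le)
  next
    case new
    have "e < e'" using M.unm_send[OF 1(1), of e'] new new_unm 1 assms(3) by auto
    then show ?thesis using before[of f f'] 1 new by auto
  qed
next
  case 1: N
  from assms(2) show ?thesis
  proof (cases rule: msg_join_cases)
    case M
    then show ?thesis using 1 before[of e' e] before[of f' f] by simp
  next
    case N
    then show ?thesis using 1 assms(3) N.fifo by simp
  next
    case new
    then show ?thesis using 1 new_label_neq[of e' f' e f] assms(3) by simp
  qed
next
  case 1: new
  from assms(2) show ?thesis
  proof (cases rule: msg_join_cases)
    case M
    have "e' < e" using M.unm_send[OF M(1), of e] 1 new_unm M assms(3) by auto
    then show ?thesis using before[of f' f] 1 M by auto
  next
    case N
    then show ?thesis using 1 new_label_neq[of e f e' f'] assms(3) by simp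
  next
    case new
    then show ?thesis using 1 new_unique by auto
  qed
qed

lemma unm_send_join:
  assumes "(e, f) \<in> msg J" "g \<in> unm J" "label J g = label J e"
  shows "e < g"
  using assms(2)
proof (cases rule: unm_join_cases)
  case g: M
  from assms(1) show ?thesis
  proof (cases rule: msg_join_cases)
    case M
    then show ?thesis using M.unm_send[OF M(1) g(1)] g assms(3) by simp
  next
    case N
    then show ?thesis using tested[OF N(1) g(1)] g assms(3) by simp
  next
    case new
    then have "e \<le> g" using new_first[OF new(1) g(1)] g assms(3) by simp
    moreover have "e \<noteq> g" using new(1) g(3) by blast
    ultimately show ?thesis by simp
  qed
next
  case g: N
  from assms(1) show ?thesis
  proof (cases rule: msg_join_cases)
    case N
    then show ?thesis using N.unm_send[OF N(1) g(1)] g assms(3) by simp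
  qed (use g before in auto)
qed

lemma unm_recv_join:
  assumes "(e, f) \<in> msg J" "g \<in> unm J" "label J g = label J f"
  shows "g < f"
  using assms(2)
proof (cases rule: unm_join_cases)
  case g: M
  from assms(1) show ?thesis
  proof (cases rule: msg_join_cases)
    case M
    then show ?thesis using M.unm_recv[OF M(1) g(1)] g assms(3) by simp
  qed (use g before in auto)
next
  case g: N
  obtain p q where "label N g = Send p q" using unm_right g by blast
  moreover from assms(1) obtain p q where "label J f = Recv p q"
    by (cases rule: msg_join_cases) (use M.msg_label N.msg_label new_label in fastforce)+
  ultimately show ?thesis using g assms(3) by simp
qed

lemma numbered_join: "numbered P J"
proof
  show "finite (events J)" "events J \<noteq> {}"
    using M.finite_events N.finite_events M.nonempty by (simp_all add: join_simps)
  show "label J \<in> events J \<rightarrow>\<^sub>E Act P"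
    using M.label N.label
    by (auto simp: join_def Let_def PiE_iff extensional_def)
  show "e < f \<and> e \<in> events J \<and> f \<in> events J" if "(e, f) \<in> msg J" for e f
    using that M.msg_less N.msg_less new_events before unfolding join_simps by blast
  show "\<exists>p q. (p, q) \<in> Ch P \<and> label J e = Send p q \<and> label J f = Recv q p" if "(e, f) \<in> msg J" for e f
    using that by (cases rule: msg_join_cases) (simp_all add: M.msg_label N.msg_label new_label)
  show "leq J = closure_leq P (events J) (label J) (msg J)"
    by (simp add: join_def Let_def)
  show "dom (content J) = unm J" "ran (content J) \<subseteq> {0}"
    by (auto simp: join_def Let_def unm_def ran_def dom_def)
qed (fact fifo_join unm_send_join unm_recv_join)+

lemma join_in_concat:
  assumes "cmsc_iso M' N"
  shows "J \<in> concat_cmsc P {0} M M'"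
proof -
  interpret J: numbered P J by (rule numbered_join)
  have refl: "cmsc_iso M M"
    unfolding cmsc_iso_def by (rule exI[of _ id]) (simp add: map_prod.id)
  have leq: "proc_leq P J p = proc_leq P M p \<union> proc_leq P N p \<union> proc_events P M p \<times> proc_events P N p"
    if "p \<in> P" for p
  proof -
    have "(e, f) \<in> numeric_leq P (events J) (label J) p \<longleftrightarrow>
      (e, f) \<in> numeric_leq P (events M) (label M) p \<union> numeric_leq P (events N) (label N) p \<union>
        proc_events P M p \<times> proc_events P N p" for e f
      using before[of e f] before[of f e] label_join[of e] label_join[of f] disjoint[of e] disjoint[of f]
      unfolding numeric_leq_def proc_events_def join_simps by auto
    then show ?thesis
      using that by (simp only: J.proc_leq_eq M.proc_leq_eq N.proc_leq_eq) auto
  qed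
  show ?thesis
    unfolding concat_cmsc_def
  proof (intro CollectI conjI exI)
    show "J \<in> cMSC P {0}" using J.fcMSC by (simp add: fcMSC_def)
    show "cmsc_iso M M" "cmsc_iso M' N" by fact+
    show "events M \<inter> events N = {}" using disjoint by blast
    show "events J = events M \<union> events N" "msg M \<union> msg N \<subseteq> msg J" by (auto simp: join_simps)
    show "\<forall>p\<in>P. proc_leq P J p = proc_leq P M p \<union> proc_leq P N p \<union> proc_events P M p \<times> proc_events P N p"
      using leq by blast
    show "\<forall>(e, f)\<in>msg J - (msg M \<union> msg N). e \<in> events M \<and> f \<in> events N \<and> content M e = content N f"
      using new_unm new_events by (auto simp: join_simps M.content_unm N.content_unm)
    show "\<forall>e\<in>events M. label J e = label M e" "\<forall>e\<in>events N. label J e = label N e"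
      by (simp_all add: label_join)
    show "\<forall>e\<in>unm J \<inter> events M. content J e = content M e"
      using disjoint unm_sub by (auto simp: J.content_unm unm_join M.content_unm)
    show "\<forall>e\<in>unm J \<inter> events N. content J e = content N e"
      using disjoint unm_sub by (auto simp: J.content_unm unm_join N.content_unm)
  qed
qed

end

lemma iso_op_cmsc: "cmsc_iso (op_cmsc 0 c) (op_cmsc n c)"
  unfolding cmsc_iso_def by (rule exI[of _ "\<lambda>k. k + n"]) (cases c; auto simp: bij_betw_def)

section \<open>Counter machines as HMSCs\<close>

definition pending :: "nat_cmsc \<Rightarrow> nat act \<Rightarrow> nat set" where
  "pending M l = {e \<in> unm M. label M e = l}"

definition counters :: "nat_cmsc \<Rightarrow> store" where
  "counters M r = card (pending M (Send 0 (Suc r)))"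

definition no_recv :: "nat_cmsc \<Rightarrow> bool" where
  "no_recv M \<longleftrightarrow> (\<forall>e\<in>unm M. \<exists>p q. label M e = Send p q)"

definition represents :: "nat set \<Rightarrow> nat_cmsc \<Rightarrow> store \<Rightarrow> bool" where
  "represents P M v \<longleftrightarrow> numbered P M \<and> counters M = v \<and>
     (\<forall>e\<in>unm M. \<exists>r. label M e = Send 0 (Suc r))"

lemma represents_op_cmsc:
  assumes "0 \<in> P" "Suc (register c) \<in> P" "(\<lambda>_. 0, v) \<in> op_rel c"
  shows "represents P (op_cmsc 0 c) v"
proof -
  have "\<forall>e\<in>unm (op_cmsc 0 c). \<exists>r. label (op_cmsc 0 c) e = Send 0 (Suc r)"
    using assms(3) by (cases c) (simp_all add: in_op_rel)
  moreover have "counters (op_cmsc 0 c) r = v r" for r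
  proof (cases c)
    case (Inc s)
    have "{e. e = 0 \<and> s = r} = (if r = s then {0} else {})" by auto
    then show ?thesis
      using assms(3) Inc unfolding counters_def pending_def by (auto simp: in_op_rel)
  next
    case (Dec s)
    then show ?thesis using assms(3) by (simp add: in_op_rel)
  next
    case (Tst s)
    then show ?thesis
      using assms(3) unfolding counters_def pending_def by (simp add: in_op_rel)
  qed
  ultimately show ?thesis
    using numbered_op_cmsc[OF assms(1,2)] by (auto simp: represents_def)
qed

lemma represents_step:
  assumes rep: "represents P M v" and step: "(v, v') \<in> op_rel c"
    and P: "0 \<in> P" "Suc (register c) \<in> P"
  shows "\<exists>M'\<in>concat_cmsc P {0} M (op_cmsc 0 c). represents P M' v'"
proof -
  interpret M: numbered P M using rep by (simp add: represents_def)
  define n where "n = Suc (Max (events M))"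
  interpret N: numbered P "op_cmsc n c" using numbered_op_cmsc[OF P] .
  have fin: "finite (unm M)" using M.finite_events by (simp add: unm_def)
  have lt: "e < n" if "e \<in> events M" for e
    using that M.finite_events by (simp add: n_def less_Suc_eq_le)
  have sub: "unm M \<subseteq> events M" by (auto simp: unm_def)
  have before: "e < f" if "e \<in> events M" "f \<in> events (op_cmsc n c)" for e f
    using lt[OF that(1)] that(2) by (cases c) auto
  have send: "\<exists>r. label M e = Send 0 (Suc r)" if "e \<in> unm M" for e
    using rep that by (simp add: represents_def)
  have v: "v r = card (pending M (Send 0 (Suc r)))" for r
    using rep by (auto simp: represents_def counters_def)
  have ch: "(0, Suc (register c)) \<in> Ch P" using P by (auto simp: Ch_def)
  show ?thesis
  proof (cases c)
    case (Inc r)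
    interpret J: joinable P M "op_cmsc n c" "{}"
      by unfold_locales (use before Inc in \<open>simp_all add: Inc\<close>)
    have unm: "unm J.J = unm M \<union> {n}"
      unfolding J.unm_join by (simp add: Inc)
    have lab: "label J.J e = label M e" if "e \<in> unm M" for e
      using J.label_join(1) sub that by blast
    have labn: "label J.J n = Send 0 (Suc r)"
      using J.label_join(2)[of n] by (simp add: Inc)
    have "counters J.J s = v' s" for s
    proof -
      have "pending J.J (Send 0 (Suc s)) =
          pending M (Send 0 (Suc s)) \<union> (if s = r then {n} else {})"
        unfolding pending_def unm using lab labn by auto
      moreover have "n \<notin> pending M l" for l using lt sub by (auto simp: pending_def)
      moreover have "finite (pending M l)" for l using fin by (simp add: pending_def)
      ultimately show ?thesis
        using step v by (simp add: counters_def Inc in_op_rel)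
    qed
    moreover have "\<forall>e\<in>unm J.J. \<exists>r. label J.J e = Send 0 (Suc r)"
      using lab labn send unfolding unm by auto
    ultimately have "represents P J.J v'"
      using J.numbered_join by (auto simp: represents_def)
    then show ?thesis using J.join_in_concat[OF iso_op_cmsc] by blast
  next
    case (Dec r)
    let ?S = "pending M (Send 0 (Suc r))"
    define a where "a = Min ?S"
    have finS: "finite ?S" using fin by (simp add: pending_def)
    have "?S \<noteq> {}" using step v[of r] by (auto simp: Dec in_op_rel)
    then have "a \<in> ?S" using finS by (simp add: a_def)
    then have a: "a \<in> unm M" "label M a = Send 0 (Suc r)" by (auto simp: pending_def)
    have amin: "a \<le> g" if "g \<in> unm M" "label M g = label M a" for g
      using that finS a by (simp add: a_def pending_def)
    interpret J: joinable P M "op_cmsc n c" "{(a, n)}"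
    proof
      show "e < f" if "e \<in> events M" "f \<in> events (op_cmsc n c)" for e f by (rule before[OF that])
      show "\<exists>p q. (p, q) \<in> Ch P \<and> label M e = Send p q \<and> label (op_cmsc n c) f = Recv q p"
        if "(e, f) \<in> {(a, n)}" for e f using that a ch by (simp add: Dec)
    qed (use a amin in \<open>auto simp: Dec\<close>)
    have unm: "unm J.J = unm M - {a}"
      unfolding J.unm_join by (simp add: Dec)
    have lab: "label J.J e = label M e" if "e \<in> unm M" for e
      using J.label_join(1) sub that by blast
    have "counters J.J s = v' s" for s
    proof -
      have "pending J.J (Send 0 (Suc s)) = pending M (Send 0 (Suc s)) - {a}"
        unfolding pending_def unm using lab by auto
      moreover have "a \<in> pending M (Send 0 (Suc s)) \<longleftrightarrow> s = r" using a by (auto simp: pending_def)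
      moreover have "v' = v(r := v r - 1)" using step by (simp add: Dec in_op_rel)
      ultimately show ?thesis
        by (simp add: counters_def v card_Diff_singleton_if)
    qed
    moreover have "\<forall>e\<in>unm J.J. \<exists>r. label J.J e = Send 0 (Suc r)"
      using lab send unfolding unm by auto
    ultimately have "represents P J.J v'"
      using J.numbered_join by (auto simp: represents_def)
    then show ?thesis using J.join_in_concat[OF iso_op_cmsc] by blast
  next
    case (Tst r)
    have "pending M (Send 0 (Suc r)) = {}"
      using step v[of r] fin by (auto simp: Tst in_op_rel pending_def)
    then have empty: "label M g \<noteq> Send 0 (Suc r)" if "g \<in> unm M" for g
      using that by (auto simp: pending_def)
    interpret J: joinable P M "op_cmsc n c" "{}"
      by unfold_locales (use before empty in \<open>auto simp: Tst\<close>)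
    have unm: "unm J.J = unm M"
      unfolding J.unm_join by (simp add: Tst)
    have lab: "label J.J e = label M e" if "e \<in> unm M" for e
      using J.label_join(1) sub that by blast
    have "pending J.J l = pending M l" for l
      unfolding pending_def unm using lab by auto
    then have "counters J.J = v'"
      using step v by (auto simp: counters_def Tst in_op_rel)
    moreover have "\<forall>e\<in>unm J.J. \<exists>r. label J.J e = Send 0 (Suc r)"
      using lab send unfolding unm by auto
    ultimately have "represents P J.J v'"
      using J.numbered_join by (auto simp: represents_def)
    then show ?thesis using J.join_in_concat[OF iso_op_cmsc] by blast
  qed
qed

lemma cMSC_msg_leq: "M \<in> cMSC P Msg \<Longrightarrow> msg M \<subseteq> leq M"
  unfolding cMSC_def by (elim CollectE conjE)

lemma cMSC_partial_order: "M \<in> cMSC P Msg \<Longrightarrow> partial_order_on (events M) (leq M)"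
  unfolding cMSC_def by (elim CollectE conjE)

lemma cMSC_leq_events: "M \<in> cMSC P Msg \<Longrightarrow> leq M \<subseteq> events M \<times> events M"
  using cMSC_partial_order[of M P Msg] by (auto simp: partial_order_on_def preorder_on_def)

lemma cMSC_antisym: "M \<in> cMSC P Msg \<Longrightarrow> antisym (leq M)"
  using cMSC_partial_order[of M P Msg] by (simp add: partial_order_on_def)

lemma cMSC_msg_events: "M \<in> cMSC P Msg \<Longrightarrow> (e, f) \<in> msg M \<Longrightarrow> e \<in> events M \<and> f \<in> events M"
  using cMSC_msg_leq cMSC_leq_events by blast

lemma cMSC_msg_label:
  assumes "M \<in> cMSC P Msg" "(e, f) \<in> msg M"
  obtains p q where "(p, q) \<in> Ch P" "label M e = Send p q" "label M f = Recv q p"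
proof -
  have "\<forall>(e, f)\<in>msg M. \<exists>(p, q)\<in>Ch P. label M e = Send p q \<and> label M f = Recv q p"
    using assms(1) unfolding cMSC_def by (elim CollectE conjE)
  then show thesis using assms(2) that by fastforce
qed

lemma cMSC_unm_send:
  assumes "M \<in> cMSC P Msg" "(e, f) \<in> msg M" "g \<in> unm M" "label M g = label M e"
  shows "(e, g) \<in> leq M" "e \<noteq> g"
proof -
  have "\<forall>(e, f)\<in>msg M. \<forall>g\<in>unm M.
        (label M g = label M e \<longrightarrow> (e, g) \<in> leq M \<and> e \<noteq> g) \<and>
        (label M g = label M f \<longrightarrow> (g, f) \<in> leq M \<and> g \<noteq> f)"
    using assms(1) unfolding cMSC_def by (elim CollectE conjE)
  then show "(e, g) \<in> leq M" "e \<noteq> g" using assms(2-) by fastforce+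
qed

lemma cMSC_fifo:
  assumes M: "M \<in> cMSC P Msg" and msg: "(e, f) \<in> msg M" "(e', f') \<in> msg M"
    and lab: "label M e = label M e' \<or> label M f = label M f'"
  shows "(e, e') \<in> leq M \<longleftrightarrow> (f, f') \<in> leq M"
proof -
  obtain p q where 1: "(p, q) \<in> Ch P" "label M e = Send p q" "label M f = Recv q p"
    using cMSC_msg_label[OF M msg(1)] .
  obtain p' q' where "(p', q') \<in> Ch P" "label M e' = Send p' q'" "label M f' = Recv q' p'"
    using cMSC_msg_label[OF M msg(2)] .
  then have 2: "label M e' = Send p q" "label M f' = Recv q p" using 1 lab by auto
  have ev: "e \<in> proc_events P M p" "e' \<in> proc_events P M p" "f \<in> proc_events P M q" "f' \<in> proc_events P M q"
    using cMSC_msg_events[OF M msg(1)] cMSC_msg_events[OF M msg(2)] 1 2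
    by (simp_all add: proc_events_def)
  have pq: "p \<in> P" "q \<in> P" using 1(1) by (auto simp: Ch_def)
  have "\<forall>p\<in>P. \<forall>q\<in>P. \<forall>(e, f)\<in>msg M. \<forall>(e', f')\<in>msg M.
        e \<in> proc_events P M p \<and> e' \<in> proc_events P M p \<and>
        f \<in> proc_events P M q \<and> f' \<in> proc_events P M q \<longrightarrow>
        ((e, e') \<in> proc_leq P M p \<longleftrightarrow> (f, f') \<in> proc_leq P M q)"
    using M unfolding cMSC_def by (elim CollectE conjE)
  note bspec[OF bspec[OF bspec[OF this pq(1)] pq(2)] msg(1), unfolded prod.case]
  from bspec[OF this msg(2), unfolded prod.case]
  have "(e, e') \<in> proc_leq P M p \<longleftrightarrow> (f, f') \<in> proc_leq P M q"
    using ev by simp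
  then show ?thesis using ev by (simp add: proc_leq_def)
qed

lemma cMSC_refl: "M \<in> cMSC P Msg \<Longrightarrow> e \<in> events M \<Longrightarrow> (e, e) \<in> leq M"
  using cMSC_partial_order[of M P Msg] by (auto simp: partial_order_on_def preorder_on_def refl_on_def)

lemma cMSC_msg_left_unique:
  assumes M: "M \<in> cMSC P Msg" and msg: "(e, f) \<in> msg M" "(e', f) \<in> msg M"
  shows "e = e'"
  using cMSC_fifo[OF M msg] cMSC_fifo[OF M msg(2,1)] cMSC_refl[OF M, of f]
    cMSC_msg_events[OF M msg(1)] antisymD[OF cMSC_antisym[OF M]] by blast

lemma cMSC_msg_right_unique:
  assumes M: "M \<in> cMSC P Msg" and msg: "(e, f) \<in> msg M" "(e, f') \<in> msg M"
  shows "f = f'"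
  using cMSC_fifo[OF M msg] cMSC_fifo[OF M msg(2,1)] cMSC_refl[OF M, of e]
    cMSC_msg_events[OF M msg(1)] antisymD[OF cMSC_antisym[OF M]] by blast

lemma cmsc_iso_pending:
  assumes iso: "cmsc_iso K N" and K: "msg K \<subseteq> events K \<times> events K"
  shows "msg N \<subseteq> events N \<times> events N" "card (pending N l) = card (pending K l)"
proof -
  obtain h where h12: "bij_betw h (events K) (events N)" "msg N = map_prod h h ` msg K"
    and "\<forall>e\<in>events K. label N (h e) = label K e \<and> content N (h e) = content K e"
    using iso unfolding cmsc_iso_def by (elim exE conjE)
  then have h3: "label N (h e) = label K e" if "e \<in> events K" for e using that by simp
  note h = h12 h3
  have img: "events N = h ` events K" and inj: "inj_on h (events K)"
    using h(1) by (auto simp: bij_betw_def)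
  show "msg N \<subseteq> events N \<times> events N"
    using K unfolding h(2) img by auto
  have mem: "(h e, h f) \<in> msg N \<longleftrightarrow> (e, f) \<in> msg K" if "e \<in> events K" "f \<in> events K" for e f
  proof
    assume "(h e, h f) \<in> msg N"
    then obtain a b where ab: "(a, b) \<in> msg K" "h a = h e" "h b = h f"
      unfolding h(2) by auto
    moreover have "a \<in> events K" "b \<in> events K" using ab(1) K by auto
    ultimately have "a = e" "b = f" using that inj_onD[OF inj] by blast+
    with ab(1) show "(e, f) \<in> msg K" by simp
  next
    assume "(e, f) \<in> msg K"
    then show "(h e, h f) \<in> msg N" unfolding h(2) by force
  qed
  have "h e \<in> unm N \<longleftrightarrow> e \<in> unm K" if "e \<in> events K" for e
  proof -
    have "(\<exists>f. (h e, f) \<in> msg N \<or> (f, h e) \<in> msg N) \<longleftrightarrow> (\<exists>f. (e, f) \<in> msg K \<or> (f, e) \<in> msg K)"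
      using mem[OF that] mem[OF _ that] \<open>msg N \<subseteq> _\<close> K unfolding img by blast
    then show ?thesis using that by (auto simp: unm_def img)
  qed
  moreover have "pending N l \<subseteq> h ` events K"
    using img by (auto simp: pending_def unm_def)
  ultimately have "pending N l = h ` pending K l"
    using h(3) by (auto simp: pending_def) (auto simp: unm_def)
  moreover have "inj_on h (pending K l)"
    using inj by (rule inj_on_subset) (auto simp: pending_def unm_def)
  ultimately show "card (pending N l) = card (pending K l)"
    by (simp add: card_image)
qed

lemma finite_pending: "finite (events M) \<Longrightarrow> finite (pending M l)"
  by (auto simp: pending_def unm_def)

lemma no_recv_iff: "no_recv M \<longleftrightarrow> (\<forall>p q. pending M (Recv p q) = {})"
  unfolding no_recv_def pending_def by (auto) (metis act.exhaust)

lemma concat_fcMSC: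
  assumes "M \<in> concat_cmsc P Msg K K'" "finite (events K)" "finite (events K')"
  shows "M \<in> fcMSC P Msg"
proof -
  obtain N1 N2 where "cmsc_iso K N1" "cmsc_iso K' N2" "events M = events N1 \<union> events N2"
    using assms(1) unfolding concat_cmsc_def by blast
  moreover have "M \<in> cMSC P Msg" using assms(1) by (simp add: concat_cmsc_def)
  ultimately show ?thesis
    using assms(2,3) by (auto simp: fcMSC_def cmsc_iso_def bij_betw_finite)
qed

lemma concat_sound:
  assumes M: "M \<in> concat_cmsc P {0} K (op_cmsc 0 c)" and "K \<in> fcMSC P {0}"
    and nr: "no_recv M" and P: "0 \<in> P" "Suc (register c) \<in> P"
  shows "no_recv K \<and> (counters K, counters M) \<in> op_rel c"
proof -
  have K: "K \<in> cMSC P {0}" "finite (events K)" using assms(2) by (simp_all add: fcMSC_def)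
  have M': "M \<in> cMSC P {0}" using M by (simp add: concat_cmsc_def)
  obtain N1 N2 where iso: "cmsc_iso K N1" "cmsc_iso (op_cmsc 0 c) N2"
    and disj: "events N1 \<inter> events N2 = {}" and ev: "events M = events N1 \<union> events N2"
    and pl: "\<forall>p\<in>P. proc_leq P M p =
        proc_leq P N1 p \<union> proc_leq P N2 p \<union> proc_events P N1 p \<times> proc_events P N2 p"
    and msub: "msg N1 \<union> msg N2 \<subseteq> msg M"
    and new: "\<forall>(e, f)\<in>msg M - (msg N1 \<union> msg N2).
        e \<in> events N1 \<and> f \<in> events N2 \<and> content N1 e = content N2 f"
    and lab1: "\<forall>e\<in>events N1. label M e = label N1 e"
    and lab2: "\<forall>e\<in>events N2. label M e = label N2 e"
    using M unfolding concat_cmsc_def by blast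
  have Ksub: "msg K \<subseteq> events K \<times> events K" using cMSC_msg_events[OF K(1)] by auto
  note N1sub = cmsc_iso_pending(1)[OF iso(1) Ksub]
  have card1: "card (pending N1 l) = card (pending K l)" for l
    by (rule cmsc_iso_pending(2)[OF iso(1) Ksub])
  have fin1: "finite (events N1)"
    using iso(1) K(2) by (auto simp: cmsc_iso_def bij_betw_finite)
  have unm1: "unm N1 \<subseteq> events N1" by (auto simp: unm_def)
  have new': "e \<in> events N1 \<and> f \<in> events N2" if "(e, f) \<in> msg M" "(e, f) \<notin> msg N1" "(e, f) \<notin> msg N2" for e f
    using new that by fastforce
  have sendM: "\<exists>p q. label M e = Send p q \<and> label M f = Recv q p" if "(e, f) \<in> msg M" for e f
    using cMSC_msg_label[OF M' that] by blast
  have N2sub: "msg N2 \<subseteq> events N2 \<times> events N2"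
    by (rule cmsc_iso_pending(1)[OF iso(2)]) (cases c; auto)
  have unm1_M: "e \<in> unm M \<or> (\<exists>f\<in>events N2. (e, f) \<in> msg M)" if "e \<in> unm N1" for e
  proof -
    have "e \<in> events N1" "e \<notin> events N2" "\<And>f. (e, f) \<notin> msg N1 \<and> (f, e) \<notin> msg N1"
      using that disj by (auto simp: unm_def)
    then show ?thesis
      using new' N2sub ev by (auto simp: unm_def) blast+
  qed
  have M_unm1: "e \<in> unm N1" if "e \<in> unm M" "e \<in> events N1" for e
    using that msub by (auto simp: unm_def)
  have nr1: "\<exists>p q. label N1 e = Send p q" if "e \<in> unm N1" for e
  proof -
    have "label M e = label N1 e" using that unm1 lab1 by blast
    moreover have "\<exists>p q. label M e = Send p q"
      using unm1_M[OF that] sendM nr unfolding no_recv_def by blast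
    ultimately show ?thesis by simp
  qed
  have "pending K (Recv p q) = {}" for p q
  proof -
    have "pending N1 (Recv p q) = {}" using nr1 by (force simp: pending_def)
    then have "card (pending K (Recv p q)) = 0" using card1 by (metis card.empty)
    then show ?thesis using finite_pending[OF K(2)] by simp
  qed
  then have "no_recv K" by (simp add: no_recv_iff)
  have counters1: "counters K r = card (pending N1 (Send 0 (Suc r)))" for r
    by (simp add: counters_def card1)
  obtain h where h: "events N2 = h ` events (op_cmsc 0 c)" "inj_on h (events (op_cmsc 0 c))"
      "msg N2 = map_prod h h ` msg (op_cmsc 0 c)"
      "\<And>e. e \<in> events (op_cmsc 0 c) \<Longrightarrow> label N2 (h e) = label (op_cmsc 0 c) e"
  proof -
    obtain h where "bij_betw h (events (op_cmsc 0 c)) (events N2)" "msg N2 = map_prod h h ` msg (op_cmsc 0 c)"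
      "\<forall>e\<in>events (op_cmsc 0 c). label N2 (h e) = label (op_cmsc 0 c) e \<and> content N2 (h e) = content (op_cmsc 0 c) e"
      using iso(2) unfolding cmsc_iso_def by (elim exE conjE)
    then show thesis using that[of h] by (simp add: bij_betw_def)
  qed
  have lab1': "label M e = label N1 e" if "e \<in> events N1" for e using lab1 that by blast
  have fp: "finite (pending N1 l)" for l using finite_pending[OF fin1] .
  have "(counters K, counters M) \<in> op_rel c"
  proof (cases c)
    case (Inc r)
    define x where "x = h 0"
    have x: "events N2 = {x}" "msg N2 = {}" "label M x = Send 0 (Suc r)"
      using h lab2 by (auto simp: Inc x_def)
    have "msg M = msg N1"
      using new' msub sendM x by fastforce
    then have unm: "unm M = unm N1 \<union> {x}"
      using ev x(1) disj N1sub by (auto simp: unm_def)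
    have "pending M (Send 0 (Suc s)) = pending N1 (Send 0 (Suc s)) \<union> (if s = r then {x} else {})" for s
      using lab1' unm1 x(3) unfolding pending_def unm by auto
    moreover have "x \<notin> pending N1 l" for l using disj x(1) unm1 by (auto simp: pending_def)
    ultimately show ?thesis
      using fp by (auto simp: Inc in_op_rel fun_eq_iff counters1) (auto simp: counters_def)
  next
    case (Dec r)
    define x where "x = h 0"
    have x: "events N2 = {x}" "msg N2 = {}" "label M x = Recv (Suc r) 0"
      using h lab2 by (auto simp: Dec x_def)
    have x1: "x \<notin> events N1" using disj x(1) by blast
    have "x \<notin> unm M" using nr x(3) by (auto simp: no_recv_def)
    then obtain a where a: "(a, x) \<in> msg M"
      using sendM x ev by (fastforce simp: unm_def)
    have "(a, x) \<notin> msg N1" using N1sub x1 by blast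
    then have a1: "a \<in> events N1" using new' a x(2) by blast
    have la: "label M a = Send 0 (Suc r)" using sendM[OF a] x(3) by auto
    have only: "(e, f) = (a, x)" if "(e, f) \<in> msg M" "(e, f) \<notin> msg N1" for e f
      using new'[OF that] x cMSC_msg_left_unique[OF M' a] that by auto
    have "msg M \<subseteq> insert (a, x) (msg N1)"
      by (rule subrelI) (use only in blast)
    then have msgM: "msg M = insert (a, x) (msg N1)" using msub a by blast
    have "(a, f) \<notin> msg N1" for f
    proof
      assume f: "(a, f) \<in> msg N1"
      then have "f = x" using cMSC_msg_right_unique[OF M' _ a] msub by blast
      then show False using f N1sub x1 by blast
    qed
    moreover have "(f, a) \<notin> msg N1" for f
      using sendM[of f a] la msub by auto
    ultimately have "a \<in> unm N1"
      using a1 by (simp add: unm_def)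
    then have unm: "unm M = unm N1 - {a}" "a \<in> unm N1"
      using msgM ev x(1) x1 unm1 by (auto simp: unm_def)
    have "pending M (Send 0 (Suc s)) = pending N1 (Send 0 (Suc s)) - {a}" for s
      using lab1' unm1 unfolding pending_def unm by auto
    moreover have "a \<in> pending N1 (Send 0 (Suc s)) \<longleftrightarrow> s = r" for s
      using unm(2) la lab1'[OF a1] by (auto simp: pending_def)
    moreover have "card (pending N1 (Send 0 (Suc r))) \<noteq> 0"
      using calculation(2)[of r] fp by auto
    ultimately show ?thesis
      by (auto simp: Dec in_op_rel fun_eq_iff counters1) (auto simp: counters_def)
  next
    case (Tst r)
    define x y where "x = h 0" and "y = h 1"
    have x: "events N2 = {x, y}" "msg N2 = {(x, y)}" "label M x = Send 0 (Suc r)" "label M y = Recv (Suc r) 0"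
      using h lab2 by (auto simp: Tst x_def y_def)
    have xy: "(x, y) \<in> msg M" using msub x(2) by blast
    have notin: "x \<notin> events N1" "y \<notin> events N1" using disj x(1) by auto
    have nonew: "(e, f) \<in> msg N1 \<union> msg N2" if "(e, f) \<in> msg M" for e f
    proof (rule ccontr)
      assume "(e, f) \<notin> msg N1 \<union> msg N2"
      then have *: "e \<in> events N1" "f \<in> {x, y}" using new'[OF that] x(1) by auto
      have "f \<noteq> x" using sendM[OF that] x(3) by auto
      then have "f = y" using *(2) by blast
      then have "e = x" using cMSC_msg_left_unique[OF M' that] xy by blast
      then show False using * notin by blast
    qed
    then have msgM: "msg M = insert (x, y) (msg N1)" using msub x(2) by auto
    have unm: "unm M = unm N1"
      using msgM ev x(1) notin N1sub by (auto simp: unm_def)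
    have pend: "pending M l = pending N1 l" for l
      using lab1' unm1 unfolding pending_def unm by auto
    have "g \<notin> pending N1 (Send 0 (Suc r))" for g
    proof
      assume "g \<in> pending N1 (Send 0 (Suc r))"
      then have g: "g \<in> unm M" "label M g = Send 0 (Suc r)" "g \<in> events N1"
        using pend unm1 unm by (auto simp: pending_def)
      then have xg: "(x, g) \<in> leq M" "x \<noteq> g"
        using cMSC_unm_send[OF M' xy] x(3) by auto
      have ch: "(0, Suc r) \<in> Ch P" using P by (auto simp: Ch_def Tst)
      have "label N1 g = Send 0 (Suc r)" "label N2 x = Send 0 (Suc r)" "x \<in> events N2"
        using g lab1' lab2 x by auto
      then have "g \<in> proc_events P N1 0" "x \<in> proc_events P N2 0"
        using g(3) ch by (simp_all add: proc_events_def)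
      then have "(g, x) \<in> proc_leq P M 0" using pl P(1) by blast
      then have "(g, x) \<in> leq M" by (simp add: proc_leq_def)
      then show False using antisymD[OF cMSC_antisym[OF M']] xg by blast
    qed
    then have "pending N1 (Send 0 (Suc r)) = {}" by blast
    then show ?thesis
      using pend by (auto simp: Tst in_op_rel fun_eq_iff counters1) (auto simp: counters_def)
  qed
  then show ?thesis using \<open>no_recv K\<close> by simp
qed

lemma op_cmsc_sound:
  assumes "no_recv (op_cmsc 0 c)"
  shows "(\<lambda>_. 0, counters (op_cmsc 0 c)) \<in> op_rel c"
proof (cases c)
  case (Inc r)
  have "pending (op_cmsc 0 c) (Send 0 (Suc s)) = (if s = r then {0} else {})" for s
    unfolding pending_def by (auto simp: Inc)
  then show ?thesis by (simp add: Inc in_op_rel fun_eq_iff) (simp add: counters_def)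
next
  case (Dec r)
  have "0 \<in> unm (op_cmsc 0 c)" by (simp add: Dec)
  then show ?thesis using assms unfolding no_recv_def by (auto simp: Dec)
next
  case (Tst r)
  have "pending (op_cmsc 0 c) l = {}" for l
    unfolding pending_def by (simp add: Tst)
  then show ?thesis by (simp add: Tst in_op_rel fun_eq_iff) (simp add: counters_def)
qed

lemma fin_prod_snoc:
  "Ms \<noteq> [] \<Longrightarrow> fin_prod_cmsc P Msg (Ms @ [N]) = (\<Union>K\<in>fin_prod_cmsc P Msg Ms. concat_cmsc P Msg K N)"
  by (cases Ms) simp_all

lemma fin_path_snoc:
  assumes "Ms \<noteq> []" "ss \<noteq> []"
  shows "fin_path H (ss @ [b]) (Ms @ [N]) \<longleftrightarrow> fin_path H ss Ms \<and> (last ss, N, b) \<in> trans_rel H"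
proof (cases "length ss = Suc (length Ms)")
  case True
  then have "last ss = ss ! length Ms" using assms by (simp add: last_conv_nth)
  then have last: "((ss @ [b]) ! length Ms, (Ms @ [N]) ! length Ms, (ss @ [b]) ! Suc (length Ms)) =
      (last ss, N, b)"
    using True by (simp add: nth_append)
  have init: "((ss @ [b]) ! i, (Ms @ [N]) ! i, (ss @ [b]) ! Suc i) = (ss ! i, Ms ! i, ss ! Suc i)"
    if "i < length Ms" for i using that True by (simp add: nth_append)
  have "fin_path H (ss @ [b]) (Ms @ [N]) \<longleftrightarrow>
      (\<forall>i<Suc (length Ms). ((ss @ [b]) ! i, (Ms @ [N]) ! i, (ss @ [b]) ! Suc i) \<in> trans_rel H)"
    using True by (simp add: fin_path_def)
  also have "\<dots> \<longleftrightarrow> (last ss, N, b) \<in> trans_rel H \<and>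
      (\<forall>i<length Ms. (ss ! i, Ms ! i, ss ! Suc i) \<in> trans_rel H)"
    unfolding All_less_Suc last using init by simp
  finally show ?thesis using True assms(1) by (auto simp: fin_path_def)
qed (simp add: fin_path_def)

locale machine =
  fixes P :: "nat set" and \<Delta> :: "(nat \<times> counter_op \<times> nat) set" and H :: nat_hmsc
  assumes P: "0 \<in> P" "(a, c, b) \<in> \<Delta> \<Longrightarrow> Suc (register c) \<in> P"
    and trans: "trans_rel H = (\<lambda>(a, c, b). (a, op_cmsc 0 c, b)) ` \<Delta>"
    and msgs: "msgs H = {0}" and final: "final H = {1}" "final_inf H = {}" and init: "init H \<noteq> 1"
begin

lemma fin_prod_fcMSC:
  assumes "Ms \<noteq> []" "set Ms \<subseteq> fcMSC P {0}" "M \<in> fin_prod_cmsc P {0} Ms"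
  shows "M \<in> fcMSC P {0}"
  using assms
proof (induction Ms arbitrary: M rule: rev_nonempty_induct)
  case (snoc N Ms)
  then obtain K where K: "K \<in> fin_prod_cmsc P {0} Ms" "M \<in> concat_cmsc P {0} K N"
    using fin_prod_snoc[OF snoc.hyps] by auto
  have "K \<in> fcMSC P {0}" "N \<in> fcMSC P {0}" using K(1) snoc by auto
  then show ?case using concat_fcMSC[OF K(2)] by (simp add: fcMSC_def)
qed simp

lemma trans_fcMSC:
  assumes "(a, N, b) \<in> trans_rel H"
  shows "N \<in> fcMSC P {0}"
proof -
  obtain c where c: "(a, c, b) \<in> \<Delta>" "N = op_cmsc 0 c" using assms by (auto simp: trans)
  interpret numbered P "op_cmsc 0 c" by (rule numbered_op_cmsc) (use P c in auto)
  show ?thesis unfolding c(2) by (rule fcMSC)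
qed

lemma path_fcMSC: "fin_path H ss Ms \<Longrightarrow> set Ms \<subseteq> fcMSC P {0}"
  using trans_fcMSC by (fastforce simp: fin_path_def in_set_conv_nth)

lemma path_sound:
  assumes "Ms \<noteq> []" "fin_path H ss Ms" "M \<in> fin_prod_cmsc P {0} Ms" "no_recv M"
  shows "((hd ss, \<lambda>_. 0), (last ss, counters M)) \<in> (steps \<Delta>)\<^sup>*"
  using assms
proof (induction Ms arbitrary: ss M rule: rev_nonempty_induct)
  case (single N)
  then obtain a b where ss: "ss = [a, b]"
    by (auto simp: fin_path_def length_Suc_conv)
  then obtain c where c: "(a, c, b) \<in> \<Delta>" "N = op_cmsc 0 c"
    using single by (auto simp: fin_path_def trans)
  then have M: "M = op_cmsc 0 c" using single by simp
  show ?case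
    using steps_edge[OF c(1) op_cmsc_sound] single M ss by simp
next
  case (snoc N Ms)
  have "ss \<noteq> []" using snoc.prems by (auto simp: fin_path_def)
  then obtain ss' b where ss: "ss = ss' @ [b]" by (cases ss rule: rev_cases) auto
  have ne: "ss' \<noteq> []" using snoc.prems by (auto simp: fin_path_def ss)
  have path: "fin_path H ss' Ms" "(last ss', N, b) \<in> trans_rel H"
    using snoc.prems(1) fin_path_snoc[OF snoc.hyps ne] by (auto simp: ss)
  obtain c where c: "(last ss', c, b) \<in> \<Delta>" "N = op_cmsc 0 c"
    using path(2) by (auto simp: trans)
  obtain K where K: "K \<in> fin_prod_cmsc P {0} Ms" "M \<in> concat_cmsc P {0} K (op_cmsc 0 c)"
    using snoc.prems(2) fin_prod_snoc[OF snoc.hyps] c(2) by auto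
  have "K \<in> fcMSC P {0}"
    by (rule fin_prod_fcMSC[OF snoc.hyps path_fcMSC[OF path(1)] K(1)])
  then have *: "no_recv K" "(counters K, counters M) \<in> op_rel c"
    using concat_sound[OF K(2) _ snoc.prems(3) P(1) P(2)[OF c(1)]] by auto
  have "((hd ss', \<lambda>_. 0), (last ss', counters K)) \<in> (steps \<Delta>)\<^sup>*"
    by (rule snoc.IH[OF path(1) K(1) *(1)])
  also have "((last ss', counters K), (b, counters M)) \<in> (steps \<Delta>)\<^sup>*"
    by (rule steps_edge[OF c(1) *(2)])
  finally show ?case using ne by (simp add: ss)
qed

lemma path_complete:
  assumes "((a, \<lambda>_. 0), (b, v)) \<in> (steps \<Delta>)\<^sup>+"
  shows "\<exists>ss Ms M. Ms \<noteq> [] \<and> fin_path H ss Ms \<and> hd ss = a \<and> last ss = b \<and>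
    M \<in> fin_prod_cmsc P {0} Ms \<and> represents P M v"
  using assms
proof (induction "(b, v)" arbitrary: b v rule: trancl_induct)
  case base
  then obtain c where c: "(a, c, b) \<in> \<Delta>" "(\<lambda>_. 0, v) \<in> op_rel c" by (auto simp: steps_def)
  have "fin_path H [a, b] [op_cmsc 0 c]"
    using c(1) by (force simp: fin_path_def trans)
  moreover have "represents P (op_cmsc 0 c) v"
    by (rule represents_op_cmsc[OF P(1) P(2)[OF c(1)] c(2)])
  ultimately show ?case
    by (intro exI[of _ "[a, b]"] exI[of _ "[op_cmsc 0 c]"] exI[of _ "op_cmsc 0 c"]) simp
next
  case (step y)
  obtain d w where y: "y = (d, w)" by fastforce
  obtain c where c: "(d, c, b) \<in> \<Delta>" "(w, v) \<in> op_rel c" using step(2) by (auto simp: steps_def y)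
  obtain ss Ms M where IH: "Ms \<noteq> []" "fin_path H ss Ms" "hd ss = a" "last ss = d"
    "M \<in> fin_prod_cmsc P {0} Ms" "represents P M w"
    using step(3)[OF y] by blast
  obtain M' where M': "M' \<in> concat_cmsc P {0} M (op_cmsc 0 c)" "represents P M' v"
    using represents_step[OF IH(6) c(2) P(1) P(2)[OF c(1)]] by blast
  have ne: "ss \<noteq> []" using IH(2) by (auto simp: fin_path_def)
  have "(d, op_cmsc 0 c, b) \<in> trans_rel H" using c(1) by (force simp: trans)
  then have "fin_path H (ss @ [b]) (Ms @ [op_cmsc 0 c])"
    using IH fin_path_snoc[OF IH(1) ne] by simp
  moreover have "M' \<in> fin_prod_cmsc P {0} (Ms @ [op_cmsc 0 c])"
    using M'(1) IH(1,5) by (auto simp: fin_prod_snoc)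
  ultimately show ?case
    using M'(2) IH(3) ne
    by (intro exI[of _ "ss @ [b]"] exI[of _ "Ms @ [op_cmsc 0 c]"] exI[of _ M']) simp
qed

theorem lang_nonempty_iff: "lang P H \<noteq> {} \<longleftrightarrow> ((init H, \<lambda>_. 0), (1, \<lambda>_. 0)) \<in> (steps \<Delta>)\<^sup>*"
proof
  assume "lang P H \<noteq> {}"
  then obtain M where "M \<in> lang P H" by blast
  then obtain ss Ms where acc: "fin_accepting H ss Ms" and M: "M \<in> fin_prod_cmsc P {0} Ms" "M \<in> MSC P {0}"
    by (auto simp: lang_def msgs inf_accepting_def final)
  have unm: "unm M = {}" using M(2) by (simp add: MSC_def)
  then have M0: "no_recv M" "counters M = (\<lambda>_. 0)"
    by (auto simp: no_recv_def counters_def pending_def)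
  have "fin_path H ss Ms" "Ms \<noteq> []" "hd ss = init H" "last ss = 1"
    using acc by (auto simp: fin_accepting_def fin_path_def final)
  with path_sound[OF _ _ M(1) M0(1), of ss] M0(2)
  show "((init H, \<lambda>_. 0), (1, \<lambda>_. 0)) \<in> (steps \<Delta>)\<^sup>*" by simp
next
  assume "((init H, \<lambda>_. 0), (1, \<lambda>_. 0)) \<in> (steps \<Delta>)\<^sup>*"
  then have "((init H, \<lambda>_. 0), (1, \<lambda>_. 0)) \<in> (steps \<Delta>)\<^sup>+"
    using init by (auto simp: rtrancl_eq_or_trancl)
  then obtain ss Ms M where *: "fin_path H ss Ms" "hd ss = init H" "last ss = 1"
    "M \<in> fin_prod_cmsc P {0} Ms" "represents P M (\<lambda>_. 0)"
    using path_complete by blast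
  interpret numbered P M using *(5) by (simp add: represents_def)
  have "unm M = {}"
  proof (rule ccontr)
    assume "unm M \<noteq> {}"
    then obtain e where "e \<in> unm M" by blast
    moreover from this obtain r where "label M e = Send 0 (Suc r)"
      using *(5) unfolding represents_def by blast
    ultimately have e: "e \<in> pending M (Send 0 (Suc r))"
      by (simp add: pending_def)
    have "card (pending M (Send 0 (Suc r))) = 0"
      using *(5) by (auto simp: represents_def counters_def fun_eq_iff)
    then show False using e finite_pending[OF finite_events] by simp
  qed
  then have "M \<in> MSC P {0}" using fcMSC by (simp add: MSC_def fcMSC_def)
  moreover have "fin_accepting H ss Ms"
    using * by (simp add: fin_accepting_def final)
  ultimately show "lang P H \<noteq> {}"
    using *(4) unfolding lang_def msgs by blast
qed

end

section \<open>Undecidability\<close>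

lemma set_encode_greater: "finite A \<Longrightarrow> x \<in> A \<Longrightarrow> x < set_encode A"
proof -
  assume "finite A" "x \<in> A"
  then have "2 ^ x \<le> set_encode A"
    unfolding set_encode_def by (intro member_le_sum) auto
  then show ?thesis using less_exp[of x] by linarith
qed

lemma list_encode_ge: "x \<in> set xs \<Longrightarrow> x \<le> list_encode xs"
proof (induction xs)
  case (Cons y ys)
  have "y \<le> prod_encode (y, list_encode ys)" "list_encode ys \<le> prod_encode (y, list_encode ys)"
    by (rule le_prod_encode_1 le_prod_encode_2)+
  then show ?case using Cons by auto
qed simp

declare list_encode.simps [simp del]

lemma set_encode_lessThan: "set_encode {..<k} = 2 ^ k - 1"
  by (simp add: set_encode_def sum_power2 flip: atLeast0LessThan)

fun trans_code :: "nat \<times> counter_op \<times> nat \<Rightarrow> nat" where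
  "trans_code (a, c, b) = list_encode [a, cmsc_code (op_cmsc 0 c), b]"

definition machine_code :: "(nat \<times> counter_op \<times> nat) set \<Rightarrow> nat" where
  "machine_code \<Delta> = set_encode (trans_code ` \<Delta>)"

definition machine_hmsc :: "(nat \<times> counter_op \<times> nat) set \<Rightarrow> nat \<Rightarrow> nat_hmsc" where
  "machine_hmsc \<Delta> n = \<lparr>states = {..<2 * n + 2}, init = 2 * n, msgs = {0},
     trans_rel = (\<lambda>(a, c, b). (a, op_cmsc 0 c, b)) ` (\<Delta> \<union> load n), final = {1}, final_inf = {}\<rparr>"

text \<open>The number \<open>n\<close> is used as the code of the transitions of the machine, as its input, and as a bound
  on its states and processes, so that the instance is determined by \<open>n\<close> alone.\<close>

definition diagonal_code :: "nat \<Rightarrow> nat" where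
  "diagonal_code n = prod_encode (2 ^ (n + 2) - 1,
     list_encode [2 ^ (n + n + 2) - 1, n + n, 1,
       n + (\<Sum>j<n. 2 ^ list_encode [j + j + 2, cmsc_code (op_cmsc 0 (Inc 0)), j + j]), 2, 0])"

lemma Suc_register_less_cmsc_code: "Suc (register c) < cmsc_code (op_cmsc 0 c)"
proof -
  let ?A = "(\<lambda>e. prod_encode (e, act_code (label (op_cmsc 0 c) e))) ` events (op_cmsc 0 c)"
  have "prod_encode (0, act_code (label (op_cmsc 0 c) 0)) < set_encode ?A"
    by (rule set_encode_greater) (cases c; auto)+
  also have "set_encode ?A \<le> cmsc_code (op_cmsc 0 c)"
    unfolding cmsc_code_def by (rule list_encode_ge) simp
  finally have "act_code (label (op_cmsc 0 c) 0) < cmsc_code (op_cmsc 0 c)"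
    using le_prod_encode_2 by (rule le_less_trans[rotated])
  moreover have "Suc (register c) \<le> act_code (label (op_cmsc 0 c) 0)"
    using le_prod_encode_2[of "Suc (register c)" 0] le_prod_encode_1[of "Suc (register c)" 0]
    by (cases c) (auto simp: sum_encode_def)
  ultimately show ?thesis by simp
qed

lemma machine_code_bounds:
  assumes "finite \<Delta>" "(a, c, b) \<in> \<Delta>"
  shows "a < machine_code \<Delta>" "b < machine_code \<Delta>" "Suc (register c) < machine_code \<Delta>"
proof -
  have "trans_code (a, c, b) < machine_code \<Delta>"
    unfolding machine_code_def by (intro set_encode_greater finite_imageI imageI assms)
  moreover have "x \<le> trans_code (a, c, b)" if "x \<in> {a, cmsc_code (op_cmsc 0 c), b}" for x
    unfolding trans_code.simps by (rule list_encode_ge) (use that in auto)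
  ultimately show "a < machine_code \<Delta>" "b < machine_code \<Delta>" "Suc (register c) < machine_code \<Delta>"
    using Suc_register_less_cmsc_code[of c] by (meson insertCI le_less_trans less_trans)+
qed

lemma load_bounds: "(a, c, b) \<in> load n \<Longrightarrow> c = Inc 0 \<and> a \<le> 2 * n \<and> b \<le> 2 * n"
  by (auto simp: load_def)

lemma instance_code_machine:
  assumes "finite \<Delta>" "\<And>a c b. (a, c, b) \<in> \<Delta> \<Longrightarrow> a = 0 \<or> odd a"
  shows "instance_code ({..<machine_code \<Delta> + 2}, machine_hmsc \<Delta> (machine_code \<Delta>)) =
    diagonal_code (machine_code \<Delta>)"
proof -
  define n where "n = machine_code \<Delta>"
  let ?h = "\<lambda>j. list_encode [j + j + 2, cmsc_code (op_cmsc 0 (Inc 0)), j + j]"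
  have inj: "inj_on ?h {..<n}" by (rule inj_onI) (simp add: list_encode_eq)
  have img: "trans_code ` load n = ?h ` {..<n}"
    by (simp add: load_def image_image mult_2)
  have "trans_code ` \<Delta> \<inter> trans_code ` load n = {}"
  proof -
    have "trans_code t \<noteq> ?h j" if t: "t \<in> \<Delta>" for t j
    proof
      assume eq: "trans_code t = ?h j"
      obtain a c b where "t = (a, c, b)" by (cases t)
      then have "a = j + j + 2" "(a, c, b) \<in> \<Delta>" using eq t by (simp_all add: list_encode_eq)
      then show False using assms(2)[of a c b] by auto
    qed
    then show ?thesis unfolding img by blast
  qed
  then have "set_encode (trans_code ` (\<Delta> \<union> load n)) =
      set_encode (trans_code ` \<Delta>) + set_encode (trans_code ` load n)"
    unfolding set_encode_def image_Un
    by (intro sum.union_disjoint) (use assms(1) in \<open>auto simp: load_def\<close>)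
  also have "set_encode (trans_code ` load n) = (\<Sum>j<n. 2 ^ ?h j)"
    unfolding img set_encode_def sum.reindex[OF inj] comp_def ..
  finally have "set_encode (trans_code ` (\<Delta> \<union> load n)) = n + (\<Sum>j<n. 2 ^ ?h j)"
    by (simp add: machine_code_def n_def)
  moreover have "(\<lambda>(s, M, t). list_encode [s, cmsc_code M, t]) ` trans_rel (machine_hmsc \<Delta> n) =
      trans_code ` (\<Delta> \<union> load n)"
    unfolding machine_hmsc_def hmsc.select_convs image_image
    by (intro image_cong refl) auto
  ultimately have "hmsc_code (machine_hmsc \<Delta> n) = list_encode [2 ^ (n + n + 2) - 1, n + n, 1,
       n + (\<Sum>j<n. 2 ^ ?h j), 2, 0]"
    unfolding hmsc_code_def
    by (simp add: machine_hmsc_def set_encode_lessThan set_encode_insert mult_2)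
  then show ?thesis
    by (simp add: n_def instance_code_def set_encode_lessThan diagonal_code_def)
qed

lemma machine_machine_hmsc:
  assumes "finite \<Delta>"
  shows "machine {..<machine_code \<Delta> + 2} (\<Delta> \<union> load (machine_code \<Delta>))
    (machine_hmsc \<Delta> (machine_code \<Delta>))"
proof
  show "Suc (register c) \<in> {..<machine_code \<Delta> + 2}"
    if "(a, c, b) \<in> \<Delta> \<union> load (machine_code \<Delta>)" for a c b
    using that machine_code_bounds(3)[OF assms, of a c b] load_bounds[of a c b] by fastforce
  show "init (machine_hmsc \<Delta> (machine_code \<Delta>)) \<noteq> 1"
    by (simp add: machine_hmsc_def)
qed (simp_all add: machine_hmsc_def)

lemma machine_instance:
  assumes "finite \<Delta>"
  shows "({..<machine_code \<Delta> + 2}, machine_hmsc \<Delta> (machine_code \<Delta>)) \<in> single_msg_instances"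
proof -
  let ?n = "machine_code \<Delta>" and ?H = "machine_hmsc \<Delta> (machine_code \<Delta>)"
  interpret machine "{..<?n + 2}" "\<Delta> \<union> load ?n" ?H
    by (rule machine_machine_hmsc[OF assms])
  have "trans_rel ?H \<subseteq> states ?H \<times> fcMSC {..<?n + 2} {0} \<times> states ?H"
  proof
    fix t assume t: "t \<in> trans_rel ?H"
    then obtain a c b where abc: "t = (a, op_cmsc 0 c, b)" "(a, c, b) \<in> \<Delta> \<union> load ?n"
      by (auto simp: trans)
    have "a < 2 * ?n + 2" "b < 2 * ?n + 2"
      using abc(2) machine_code_bounds(1,2)[OF assms, of a c b] load_bounds[of a c b ?n] by auto
    moreover have "op_cmsc 0 c \<in> fcMSC {..<?n + 2} {0}"
      using t trans_fcMSC unfolding abc by blast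
    ultimately show "t \<in> states ?H \<times> fcMSC {..<?n + 2} {0} \<times> states ?H"
      by (simp add: abc machine_hmsc_def)
  qed
  moreover have "finite (trans_rel ?H)"
    using assms by (simp add: trans load_def)
  ultimately have "?H \<in> HMSC {..<?n + 2}"
    by (simp add: HMSC_def msgs final) (simp add: machine_hmsc_def)
  then show ?thesis
    by (auto simp: single_msg_instances_def msgs)
qed

lemma computable_diagonal_code: "computable (Suc 0) (\<lambda>xs. diagonal_code (xs ! 0))"
proof -
  have id: "computable (Suc 0) (\<lambda>xs. xs ! 0)" by (rule computable_nth) simp
  have add2: "computable (Suc 0) (\<lambda>xs. A xs + 2)" if "computable (Suc 0) A" for A
    by (intro computable_add computable_const that)
  let ?h = "\<lambda>j. list_encode [j + j + 2, cmsc_code (op_cmsc 0 (Inc 0)), j + j]"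
  have "computable (Suc 0) (\<lambda>xs. ?h (xs ! 0))"
    using computable_list_encode[of "[\<lambda>xs. xs ! 0 + xs ! 0 + 2, \<lambda>_. cmsc_code (op_cmsc 0 (Inc 0)),
        \<lambda>xs. xs ! 0 + xs ! 0]" "Suc 0"] computable_add[OF id id] add2 computable_const
    by fastforce
  then have "computable (Suc 0) (\<lambda>xs. \<Sum>j<xs ! 0. 2 ^ ?h j)"
    using id by (rule computable_sum_power2)
  note * = this computable_add[OF id this] computable_add[OF id id]
    computable_power2_minus_1[OF add2[OF id]]
    computable_power2_minus_1[OF add2[OF computable_add[OF id id]]]
  have "computable (Suc 0) (\<lambda>xs. list_encode (map (\<lambda>A. A xs)
     [\<lambda>xs. 2 ^ (xs ! 0 + xs ! 0 + 2) - 1, \<lambda>xs. xs ! 0 + xs ! 0, \<lambda>_. 1,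
       \<lambda>xs. xs ! 0 + (\<Sum>j<xs ! 0. 2 ^ ?h j), \<lambda>_. 2, \<lambda>_. 0]))"
    by (rule computable_list_encode) (use * computable_const in \<open>auto\<close>)
  then have "computable (Suc 0) (\<lambda>xs. list_encode
     [2 ^ (xs ! 0 + xs ! 0 + 2) - 1, xs ! 0 + xs ! 0, 1,
       xs ! 0 + (\<Sum>j<xs ! 0. 2 ^ ?h j), 2, 0])"
    by (simp only: list.map)
  then show ?thesis
    unfolding diagonal_code_def by (intro computable_prod_encode *)
qed

theorem theorem5:
  shows "\<not> decidable_problem instance_code single_msg_instances (\<lambda>(P, H). lang P H \<noteq> {})"
proof
  assume "decidable_problem instance_code single_msg_instances (\<lambda>(P, H). lang P H \<noteq> {})"
  then obtain f where f: "\<And>P H. (P, H) \<in> single_msg_instances \<Longrightarrow>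
      rec_eval f [instance_code (P, H)] (if lang P H \<noteq> {} then 1 else 0)"
    unfolding decidable_problem_def by fast
  obtain e where e: "\<And>xs. length xs = Suc 0 \<Longrightarrow> rec_eval e xs (diagonal_code (xs ! 0))"
    using computable_diagonal_code unfolding computable_def by blast
  have g: "rec_eval (Comp f [e]) [n] y \<longleftrightarrow> rec_eval f [diagonal_code n] y" for n y
    using e[of "[n]"] rec_eval_deterministic[of e "[n]"]
    by (auto simp: rec_eval_Comp list_all2_Cons1)
  obtain \<Delta> where \<Delta>: "finite \<Delta>" "\<And>a c b. (a, c, b) \<in> \<Delta> \<Longrightarrow> a = 0 \<or> odd a"
    and run: "\<And>n. ((2 * n, \<lambda>_. 0), (1, \<lambda>_. 0)) \<in> (steps (\<Delta> \<union> load n))\<^sup>* \<longleftrightarrow>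
      rec_eval (Comp f [e]) [n] 0"
    using machine_for_recf[of "Comp f [e]"] by blast
  define n where "n = machine_code \<Delta>"
  define H where "H = machine_hmsc \<Delta> n"
  interpret machine "{..<n + 2}" "\<Delta> \<union> load n" H
    unfolding n_def H_def by (rule machine_machine_hmsc[OF \<Delta>(1)])
  have "lang {..<n + 2} H \<noteq> {} \<longleftrightarrow> rec_eval f [diagonal_code n] 0"
    using lang_nonempty_iff run[of n] g by (simp add: H_def machine_hmsc_def)
  moreover have "rec_eval f [diagonal_code n] (if lang {..<n + 2} H \<noteq> {} then 1 else 0)"
    using f[OF machine_instance[OF \<Delta>(1)]] instance_code_machine[OF \<Delta>] by (simp add: n_def H_def)
  ultimately show False
    using rec_eval_deterministic[of f "[diagonal_code n]" 0 1] by (auto split: if_splits)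
qed

end
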